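(* Let $E$ and $F$ be Archimedean Riesz spaces, let $F^{\delta}$ be an order completion of $F$ with corresponding bipositive linear map $i:F\to F^{\delta}$, and suppose that $\mathcal{L}^r(E,F)$ is pervasive in $\mathcal{L}^r(E,F^{\delta})$ (that is, for every $T\in\mathcal{L}^r(E,F^{\delta})$ with $T>0$ there is $S\in\mathcal{L}^r(E,i(F))$ with $0<S\le T$). Then: (1) the Riesz completion $\mathcal{L}^r(E,F)^{\rho}$ of $\mathcal{L}^r(E,F)$ can be identified with the Riesz subspace $\mathcal{S}$ of $\mathcal{L}^r(E,F^{\delta})$ generated by $\mathcal{L}^r(E,i(F))$; i.e. $\mathcal{S}$, together with the map $\mathcal{L}^r(E,F)\to\mathcal{S}$, $T\mapsto i\circ T$, is a Riesz completion of $\mathcal{L}^r(E,F)$; (2) $\mathcal{L}^r(E,F)$ has the Riesz-Kantorovich property: for each $T\in\mathcal{L}^r(E,F)$ such that $T^+=\sup\{T,0\}$ exists in $\mathcal{L}^r(E,F)$, one has $T^+(x)=\sup\{T(y)\mid y\in[0,x]\}$ (supremum in $F$) for each $x\in E_+$; (3) $\mathcal{L}^{oc}(E,F)\cap\mathcal{L}^r(E,F)$ is a band of $\mathcal{L}^r(E,F)$.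
   Context: Riesz space = vector lattice. $\mathcal{L}^r(E,F)$ is the space of regular operators $E\to F$ (differences of positive linear operators), ordered pointwise on $E_+$: $S\le T$ iff $S(x)\le T(x)$ for all $x\in E_+$; it is a directed Archimedean partially ordered vector space (not a lattice in general). When $F$ is order complete it is an order complete Riesz space. Order completion: an order complete Riesz space $F^{\delta}$ with a linear bipositive map $i:F\to F^{\delta}$ ($x\ge 0$ iff $i(x)\ge 0$) such that $i(F)$ is majorizing (every element of $F^\delta$ lies below some element of $i(F)$) and pervasive in $F^{\delta}$ (for every $0<x\in F^\delta$ there is $y\in i(F)$ with $0<y\le x$). $\mathcal{L}^r(E,i(F))$ is regarded as a subspace of $\mathcal{L}^r(E,F^{\delta})$. A Riesz completion of a directed Archimedean partially ordered vector space $X$ is a Riesz space $X^{\rho}$ with a bipositive linear map $j:X\to X^{\rho}$ such that $j(X)$ is order dense in $X^{\rho}$ (every $x\in X^{\rho}$ satisfies $x=\sup\{y\in j(X)\mid y\le x\}=\inf\{y\in j(X)\mid y\ge x\}$) and the smallest Riesz subspace of $X^{\rho}$ containing $j(X)$ is $X^{\rho}$ itself. Riesz completions are unique up to Riesz isomorphism. Order convergence in a Riesz space $X$: $x_\alpha\xrightarrow{o}x$ if there is a net $(b_\gamma)_{\gamma\in\Lambda}$ in $X$ (possibly with a different index set) with $b_\gamma\downarrow 0$ such that for every $\gamma$ there is $\alpha_0$ with $|x_\alpha-x|\le b_\gamma$ for all $\alpha\ge\alpha_0$. $\mathcal{L}^{oc}(E,F)$ is the space of linear operators $T:E\to F$ such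 that $x_\alpha\xrightarrow{o}0$ in $E$ implies $T(x_\alpha)\xrightarrow{o}0$ in $F$ for every net. In a partially ordered vector space $X$, for $A\subseteq X$ let $A^u$ be the set of upper bounds of $A$ in $X$. Elements $x,y$ are disjoint, $x\perp y$, if $\{x+y,-x-y\}^u=\{x-y,-x+y\}^u$. For a subspace $Y$, $Y^d=\{x\in X\mid x\perp y\text{ for all }y\in Y\}$ (and likewise for subsets), and $Y$ is a band of $X$ if $Y^{dd}=Y$. *)

theory Defs
  imports "HOL-Analysis.Analysis" "HOL-Library.Lub_Glb" "HOL-Library.Lattice_Algebras"
begin

section \<open>Riesz spaces and partially ordered vector spaces\<close>

text \<open>The operation \<open>abs\<close> is determined by the lattice structure, \<open>\<bar>x\<bar> = sup x (- x)\<close>, so it is a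
  notation and not additional structure.\<close>

class riesz_space = ordered_real_vector + lattice_ab_group_add_abs

text \<open>In the remaining notions of this section a carrier set \<open>X\<close> is a partially ordered vector
  space under the order inherited from its type. Suprema and infima relative to \<open>X\<close> are
  \<open>isLub X\<close> and \<open>isGlb X\<close>.\<close>

definition archimedean_on :: "'v::ordered_real_vector set \<Rightarrow> bool" where
  "archimedean_on X \<longleftrightarrow>
     (\<forall>x\<in>X. \<forall>y\<in>X. (\<forall>n::nat. 0 < n \<longrightarrow> real n *\<^sub>R x \<le> y) \<longrightarrow> x \<le> 0)"

definition directed_on :: "'v::ordered_real_vector set \<Rightarrow> bool" where
  "directed_on X \<longleftrightarrow> (\<forall>x\<in>X. \<forall>y\<in>X. \<exists>z\<in>X. x \<le> z \<and> y \<le> z)"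

definition riesz_space_on :: "'v::ordered_real_vector set \<Rightarrow> bool" where
  "riesz_space_on X \<longleftrightarrow> subspace X \<and>
     (\<forall>x\<in>X. \<forall>y\<in>X. (\<exists>s. isLub X {x, y} s) \<and> (\<exists>t. isGlb X {x, y} t))"

text \<open>Suprema and infima of pairs are formed in the surrounding space \<open>X\<close>, not in \<open>Y\<close>.\<close>

definition riesz_subspace :: "'v::ordered_real_vector set \<Rightarrow> 'v set \<Rightarrow> bool" where
  "riesz_subspace X Y \<longleftrightarrow> subspace Y \<and> Y \<subseteq> X \<and>
     (\<forall>x\<in>Y. \<forall>y\<in>Y. (\<exists>s\<in>Y. isLub X {x, y} s) \<and> (\<exists>t\<in>Y. isGlb X {x, y} t))"

definition pervasive_in :: "'v::ordered_real_vector set \<Rightarrow> 'v set \<Rightarrow> bool" where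
  "pervasive_in Y X \<longleftrightarrow> (\<forall>x\<in>X. 0 < x \<longrightarrow> (\<exists>y\<in>Y. 0 < y \<and> y \<le> x))"

definition majorizing :: "'v::ordered_real_vector set \<Rightarrow> 'v set \<Rightarrow> bool" where
  "majorizing Y X \<longleftrightarrow> (\<forall>x\<in>X. \<exists>y\<in>Y. x \<le> y)"

definition order_dense :: "'v::ordered_real_vector set \<Rightarrow> 'v set \<Rightarrow> bool" where
  "order_dense Y X \<longleftrightarrow>
     (\<forall>x\<in>X. isLub X {y\<in>Y. y \<le> x} x \<and> isGlb X {y\<in>Y. x \<le> y} x)"

definition bipositive :: "('v::ordered_real_vector \<Rightarrow> 'w::ordered_real_vector) \<Rightarrow> bool" where
  "bipositive j \<longleftrightarrow> (\<forall>x. 0 \<le> x \<longleftrightarrow> 0 \<le> j x)"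

definition order_complete_on :: "'v::ordered_real_vector set \<Rightarrow> bool" where
  "order_complete_on X \<longleftrightarrow>
     (\<forall>A. A \<subseteq> X \<and> A \<noteq> {} \<and> (\<exists>u. isUb X A u) \<longrightarrow> (\<exists>s. isLub X A s))"

definition order_completion :: "('f::riesz_space \<Rightarrow> 'g::riesz_space) \<Rightarrow> bool" where
  "order_completion i \<longleftrightarrow> order_complete_on (UNIV :: 'g set) \<and> linear i \<and> bipositive i \<and>
     majorizing (range i) UNIV \<and> pervasive_in (range i) UNIV"

text \<open>\<open>riesz_completion Y j\<close>: the set \<open>Y\<close> together with \<open>j\<close> is a Riesz completion of the
  directed Archimedean partially ordered vector space formed by the whole domain type of \<open>j\<close>.\<close>

definition riesz_completion ::
    "'w::ordered_real_vector set \<Rightarrow> ('v::ordered_real_vector \<Rightarrow> 'w) \<Rightarrow> bool" where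
  "riesz_completion Y j \<longleftrightarrow>
     directed_on (UNIV :: 'v set) \<and> archimedean_on (UNIV :: 'v set) \<and>
     riesz_space_on Y \<and> range j \<subseteq> Y \<and> linear j \<and> bipositive j \<and>
     order_dense (range j) Y \<and> riesz_subspace Y hull range j = Y"

definition po_disjoint :: "'v::ordered_real_vector \<Rightarrow> 'v \<Rightarrow> bool" where
  "po_disjoint x y \<longleftrightarrow> ubs UNIV {x + y, - x - y} = ubs UNIV {x - y, - x + y}"

definition disjoint_complement :: "'v::ordered_real_vector set \<Rightarrow> 'v set" where
  "disjoint_complement Y = {x. \<forall>y\<in>Y. po_disjoint x y}"

definition is_band :: "'v::ordered_real_vector set \<Rightarrow> bool" where
  "is_band Y \<longleftrightarrow> subspace Y \<and> disjoint_complement (disjoint_complement Y) = Y"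


section \<open>Order convergence\<close>

text \<open>A net is a function on a directed index set \<open>D\<close>; \<open>(a, b) \<in> r\<close> means that \<open>b\<close> comes
  after \<open>a\<close>.\<close>

definition directed_index :: "'i set \<Rightarrow> 'i rel \<Rightarrow> bool" where
  "directed_index D r \<longleftrightarrow> D \<noteq> {} \<and> preorder_on D r \<and>
     (\<forall>a\<in>D. \<forall>b\<in>D. \<exists>c\<in>D. (a, c) \<in> r \<and> (b, c) \<in> r)"

definition decreases_to_zero :: "'k set \<Rightarrow> 'k rel \<Rightarrow> ('k \<Rightarrow> 'v::riesz_space) \<Rightarrow> bool" where
  "decreases_to_zero K s b \<longleftrightarrow> directed_index K s \<and>
     (\<forall>c d. (c, d) \<in> s \<longrightarrow> b d \<le> b c) \<and> isGlb UNIV (b ` K) 0"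

definition dominates ::
    "'i set \<Rightarrow> 'i rel \<Rightarrow> ('i \<Rightarrow> 'v::riesz_space) \<Rightarrow> 'v \<Rightarrow> 'k set \<Rightarrow> ('k \<Rightarrow> 'v) \<Rightarrow> bool" where
  "dominates D r x l K b \<longleftrightarrow>
     (\<forall>c\<in>K. \<exists>a0\<in>D. \<forall>a\<in>D. (a0, a) \<in> r \<longrightarrow> \<bar>x a - l\<bar> \<le> b c)"

text \<open>HOL cannot quantify over the type of indices inside a formula. The dominating net is therefore
  indexed by elements of the space itself; by \<open>order_convergesI\<close> below this is no restriction.\<close>

definition order_converges ::
    "'i set \<Rightarrow> 'i rel \<Rightarrow> ('i \<Rightarrow> 'v::riesz_space) \<Rightarrow> 'v \<Rightarrow> bool" where
  "order_converges D r x l \<longleftrightarrow>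
     (\<exists>(K :: 'v set) s b. decreases_to_zero K s b \<and> dominates D r x l K b)"

lemma order_convergesI:
  fixes x :: "'i \<Rightarrow> 'v::riesz_space" and b :: "'k \<Rightarrow> 'v"
  assumes b: "decreases_to_zero K s b" and dom: "dominates D r x l K b"
  shows "order_converges D r x l"
proof -
  let ?s = "{(c, d). c \<in> b ` K \<and> d \<in> b ` K \<and> d \<le> c}"
  have "preorder_on (b ` K) ?s"
    by (auto simp: preorder_on_def refl_on_def intro: transI)
  moreover have "\<exists>e\<in>b ` K. (c, e) \<in> ?s \<and> (d, e) \<in> ?s" if cd: "c \<in> b ` K" "d \<in> b ` K" for c d
  proof -
    obtain p where p: "p \<in> K" "c = b p" using cd(1) by blast
    obtain q where q: "q \<in> K" "d = b q" using cd(2) by blast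
    obtain t where "t \<in> K" "(p, t) \<in> s" "(q, t) \<in> s"
      using b p(1) q(1) unfolding decreases_to_zero_def directed_index_def by meson
    moreover from this have "b t \<le> c" "b t \<le> d"
      using p q b unfolding decreases_to_zero_def by blast+
    ultimately show ?thesis using cd by blast
  qed
  moreover have "b ` K \<noteq> {}"
    using b unfolding decreases_to_zero_def directed_index_def by blast
  ultimately have "directed_index (b ` K) ?s"
    unfolding directed_index_def by blast
  then have "decreases_to_zero (b ` K) ?s id"
    using b unfolding decreases_to_zero_def by simp
  moreover have "dominates D r x l (b ` K) id"
    using dom unfolding dominates_def by simp
  ultimately show ?thesis unfolding order_converges_def by blast
qed

text \<open>Likewise the nets in the definition of order continuity are indexed by pairs of a set and a
  point; by \<open>order_continuousD\<close> below an order continuous operator preserves order null nets over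
  index sets of any type.\<close>

definition order_continuous_operators :: "('e::riesz_space \<Rightarrow> 'f::riesz_space) set" where
  "order_continuous_operators = {T. linear T \<and>
     (\<forall>(D :: ('e set \<times> 'e) set) r x. directed_index D r \<longrightarrow>
        order_converges D r x 0 \<longrightarrow> order_converges D r (\<lambda>a. T (x a)) 0)}"

lemma order_continuousD:
  fixes x :: "'i \<Rightarrow> 'e::riesz_space" and T :: "'e \<Rightarrow> 'f::riesz_space"
  assumes T: "T \<in> order_continuous_operators"
    and D: "directed_index D r" and x: "order_converges D r x 0"
  shows "order_converges D r (\<lambda>a. T (x a)) 0"
proof -
  define tail where "tail a = x ` {c \<in> D. (a, c) \<in> r}" for a
  define D' where "D' = {(tail a, y) | a y. a \<in> D \<and> y \<in> tail a}"
  define r' where "r' = {(p, q). p \<in> D' \<and> q \<in> D' \<and> fst q \<subseteq> fst p}"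
  have refl: "(a, a) \<in> r" if "a \<in> D" for a
    using D that unfolding directed_index_def preorder_on_def refl_on_def by auto
  have trans: "(a, d) \<in> r" if "(a, c) \<in> r" "(c, d) \<in> r" for a c d
    using D that unfolding directed_index_def preorder_on_def by (meson transD)
  have in_tail: "x a \<in> tail a" if "a \<in> D" for a
    using that refl unfolding tail_def by auto
  have tail_mono: "tail c \<subseteq> tail a" if "(a, c) \<in> r" for a c
    using that trans unfolding tail_def by blast
  have "preorder_on D' r'"
    unfolding preorder_on_def r'_def by (auto simp: refl_on_def intro!: transI)
  moreover have "D' \<noteq> {}"
    using D in_tail unfolding directed_index_def D'_def by auto
  moreover have "\<exists>t\<in>D'. (p, t) \<in> r' \<and> (q, t) \<in> r'" if pq: "p \<in> D'" "q \<in> D'" for p q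
  proof -
    obtain a c where ac: "a \<in> D" "fst p = tail a" "c \<in> D" "fst q = tail c"
      using pq unfolding D'_def by auto
    then obtain e where e: "e \<in> D" "(a, e) \<in> r" "(c, e) \<in> r"
      using D unfolding directed_index_def by meson
    have "(tail e, x e) \<in> D'" using e in_tail unfolding D'_def by auto
    moreover from this have "(p, (tail e, x e)) \<in> r'" "(q, (tail e, x e)) \<in> r'"
      using pq ac tail_mono[OF e(2)] tail_mono[OF e(3)] unfolding r'_def by simp_all
    ultimately show ?thesis by blast
  qed
  ultimately have dir: "directed_index D' r'"
    unfolding directed_index_def by blast
  have "order_converges D' r' snd 0"
  proof -
    obtain K :: "'e set" and s b
      where b: "decreases_to_zero K s b" and dom: "dominates D r x 0 K b"
      using x unfolding order_converges_def by blast
    have "dominates D' r' snd 0 K b"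
      unfolding dominates_def
    proof
      fix k assume "k \<in> K"
      then obtain a where a: "a \<in> D" "\<forall>c\<in>D. (a, c) \<in> r \<longrightarrow> \<bar>x c - 0\<bar> \<le> b k"
        using dom unfolding dominates_def by blast
      then have "\<forall>y\<in>tail a. \<bar>y - 0\<bar> \<le> b k" unfolding tail_def by auto
      moreover have "snd p \<in> tail a" if "((tail a, x a), p) \<in> r'" for p
        using that unfolding r'_def D'_def by auto
      moreover have "(tail a, x a) \<in> D'" using a in_tail unfolding D'_def by auto
      ultimately show "\<exists>a0\<in>D'. \<forall>a\<in>D'. (a0, a) \<in> r' \<longrightarrow> \<bar>snd a - 0\<bar> \<le> b k" by blast
    qed
    with b show ?thesis unfolding order_converges_def by blast
  qed
  then have "order_converges D' r' (\<lambda>p. T (snd p)) 0"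
    using T dir unfolding order_continuous_operators_def by blast
  then obtain K :: "'f set" and s b
    where b: "decreases_to_zero K s b" and dom: "dominates D' r' (\<lambda>p. T (snd p)) 0 K b"
    unfolding order_converges_def by blast
  have "dominates D r (\<lambda>a. T (x a)) 0 K b"
    unfolding dominates_def
  proof
    fix k assume "k \<in> K"
    then obtain p where p: "p \<in> D'" "\<forall>q\<in>D'. (p, q) \<in> r' \<longrightarrow> \<bar>T (snd q) - 0\<bar> \<le> b k"
      using dom unfolding dominates_def by blast
    obtain a where a: "a \<in> D" "fst p = tail a" using p(1) unfolding D'_def by auto
    have "\<bar>T (x c) - 0\<bar> \<le> b k" if "c \<in> D" "(a, c) \<in> r" for c
    proof -
      have "(tail c, x c) \<in> D'" using that in_tail unfolding D'_def by auto
      moreover from this have "(p, (tail c, x c)) \<in> r'"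
        using p(1) a(2) tail_mono[OF that(2)] unfolding r'_def by auto
      ultimately show ?thesis using p(2) by fastforce
    qed
    with a(1) show "\<exists>a0\<in>D. \<forall>a\<in>D. (a0, a) \<in> r \<longrightarrow> \<bar>T (x a) - 0\<bar> \<le> b k" by blast
  qed
  with b show ?thesis unfolding order_converges_def by blast
qed


section \<open>Regular operators\<close>

definition positive_operator :: "('e::ordered_real_vector \<Rightarrow> 'f::ordered_real_vector) \<Rightarrow> bool" where
  "positive_operator T \<longleftrightarrow> linear T \<and> (\<forall>x\<ge>0. 0 \<le> T x)"

lemma positive_operator_add:
  "positive_operator P \<Longrightarrow> positive_operator Q \<Longrightarrow> positive_operator (\<lambda>x. P x + Q x)"
  by (auto simp: positive_operator_def intro: linear_compose_add)

lemma positive_operator_scaleR: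
  "0 \<le> a \<Longrightarrow> positive_operator P \<Longrightarrow> positive_operator (\<lambda>x. a *\<^sub>R P x)"
  by (auto simp: positive_operator_def scaleR_nonneg_nonneg intro: linear_compose_scale_right)

lemma positive_operator_zero: "positive_operator (\<lambda>x. 0)"
  by (simp add: positive_operator_def linear_iff)

typedef (overloaded) ('e, 'f) regular_operator =
  "{T :: 'e::riesz_space \<Rightarrow> 'f::riesz_space.
      \<exists>P Q. positive_operator P \<and> positive_operator Q \<and> T = (\<lambda>x. P x - Q x)}"
  morphisms app Regular_operator
proof -
  have "(\<lambda>x. 0) = (\<lambda>x. (0::'f) - 0)" by simp
  then show ?thesis using positive_operator_zero by blast
qed

setup_lifting type_definition_regular_operator

lemma linear_app: "linear (app T)"
  using app[of T] by (auto simp: positive_operator_def intro: linear_compose_sub)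

instantiation regular_operator :: (riesz_space, riesz_space) ordered_real_vector
begin

lift_definition zero_regular_operator :: "('a, 'b) regular_operator" is "\<lambda>x. 0"
proof -
  have "(\<lambda>x::'a. 0) = (\<lambda>x. (0::'b) - 0)" by simp
  then show "\<exists>P Q. positive_operator P \<and> positive_operator Q \<and> (\<lambda>x::'a. (0::'b)) = (\<lambda>x. P x - Q x)"
    using positive_operator_zero by blast
qed

lift_definition plus_regular_operator ::
    "('a, 'b) regular_operator \<Rightarrow> ('a, 'b) regular_operator \<Rightarrow> ('a, 'b) regular_operator"
  is "\<lambda>S T x. S x + T x"
proof clarify
  fix P Q P' Q' :: "'a \<Rightarrow> 'b"
  assume *: "positive_operator P" "positive_operator Q" "positive_operator P'" "positive_operator Q'"
  have "(\<lambda>x. P x - Q x + (P' x - Q' x)) = (\<lambda>x. (P x + P' x) - (Q x + Q' x))"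
    by (simp add: fun_eq_iff)
  then show "\<exists>R R'. positive_operator R \<and> positive_operator R' \<and>
      (\<lambda>x. P x - Q x + (P' x - Q' x)) = (\<lambda>x. R x - R' x)"
    using * positive_operator_add by blast
qed

lift_definition uminus_regular_operator ::
    "('a, 'b) regular_operator \<Rightarrow> ('a, 'b) regular_operator" is "\<lambda>T x. - T x"
proof clarify
  fix P Q :: "'a \<Rightarrow> 'b"
  assume *: "positive_operator P" "positive_operator Q"
  have "(\<lambda>x. - (P x - Q x)) = (\<lambda>x. Q x - P x)" by (simp add: fun_eq_iff)
  with * show "\<exists>R R'. positive_operator R \<and> positive_operator R' \<and>
      (\<lambda>x. - (P x - Q x)) = (\<lambda>x. R x - R' x)" by blast
qed

definition minus_regular_operator ::
    "('a, 'b) regular_operator \<Rightarrow> ('a, 'b) regular_operator \<Rightarrow> ('a, 'b) regular_operator"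
  where "minus_regular_operator S T = S + (- T)"

lift_definition scaleR_regular_operator ::
    "real \<Rightarrow> ('a, 'b) regular_operator \<Rightarrow> ('a, 'b) regular_operator" is "\<lambda>a T x. a *\<^sub>R T x"
proof clarify
  fix a :: real and P Q :: "'a \<Rightarrow> 'b"
  assume *: "positive_operator P" "positive_operator Q"
  show "\<exists>R R'. positive_operator R \<and> positive_operator R' \<and>
      (\<lambda>x. a *\<^sub>R (P x - Q x)) = (\<lambda>x. R x - R' x)"
  proof (cases "0 \<le> a")
    case True
    have "(\<lambda>x. a *\<^sub>R (P x - Q x)) = (\<lambda>x. a *\<^sub>R P x - a *\<^sub>R Q x)"
      by (simp add: fun_eq_iff scaleR_diff_right)
    then show ?thesis using * True positive_operator_scaleR by blast
  next
    case False
    then have "0 \<le> - a" by simp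
    moreover have "(\<lambda>x. a *\<^sub>R (P x - Q x)) = (\<lambda>x. (- a) *\<^sub>R Q x - (- a) *\<^sub>R P x)"
      by (simp add: fun_eq_iff scaleR_diff_right)
    ultimately show ?thesis using * positive_operator_scaleR by blast
  qed
qed

definition less_eq_regular_operator ::
    "('a, 'b) regular_operator \<Rightarrow> ('a, 'b) regular_operator \<Rightarrow> bool"
  where "less_eq_regular_operator S T \<longleftrightarrow> (\<forall>x\<ge>0. app S x \<le> app T x)"

definition less_regular_operator ::
    "('a, 'b) regular_operator \<Rightarrow> ('a, 'b) regular_operator \<Rightarrow> bool"
  where "less_regular_operator S T \<longleftrightarrow> S \<le> T \<and> \<not> T \<le> S"

instance
proof
  fix R S T :: "('a, 'b) regular_operator" and a b :: real
  note app_simps = app_inject[symmetric] zero_regular_operator.rep_eq plus_regular_operator.rep_eq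
    uminus_regular_operator.rep_eq scaleR_regular_operator.rep_eq minus_regular_operator_def
    fun_eq_iff
  show "R + S + T = R + (S + T)" "R + S = S + R" "0 + R = R" "- R + R = 0" "R - S = R + - S"
    by (simp_all add: app_simps algebra_simps)
  show "a *\<^sub>R (S + T) = a *\<^sub>R S + a *\<^sub>R T" "(a + b) *\<^sub>R S = a *\<^sub>R S + b *\<^sub>R S"
    "a *\<^sub>R b *\<^sub>R S = (a * b) *\<^sub>R S" "1 *\<^sub>R S = S"
    by (simp_all add: app_simps algebra_simps)
  show "S < T \<longleftrightarrow> S \<le> T \<and> \<not> T \<le> S" by (rule less_regular_operator_def)
  show "S \<le> S" by (simp add: less_eq_regular_operator_def)
  show "R \<le> T" if "R \<le> S" "S \<le> T"
    using that unfolding less_eq_regular_operator_def by (meson order_trans)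
  show "S = T" if "S \<le> T" "T \<le> S"
  proof -
    have pos: "app S x = app T x" if "0 \<le> x" for x
      using \<open>S \<le> T\<close> \<open>T \<le> S\<close> that unfolding less_eq_regular_operator_def by (simp add: antisym)
    have "app S x = app T x" for x
    proof -
      have x: "x = sup x 0 - (sup x 0 - x)" by simp
      have "app S x = app S (sup x 0) - app S (sup x 0 - x)"
        by (subst x) (simp only: linear_diff[OF linear_app])
      also have "\<dots> = app T (sup x 0) - app T (sup x 0 - x)"
        by (simp only: pos sup_ge1 sup_ge2 diff_ge_0_iff_ge)
      also have "\<dots> = app T x"
        by (subst (3) x) (simp only: linear_diff[OF linear_app])
      finally show ?thesis .
    qed
    then show ?thesis by (simp add: app_simps)
  qed
  show "R + S \<le> R + T" if "S \<le> T"
    using that by (simp add: less_eq_regular_operator_def plus_regular_operator.rep_eq)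
  show "a *\<^sub>R S \<le> a *\<^sub>R T" if "S \<le> T" "0 \<le> a"
    using that by (simp add: less_eq_regular_operator_def scaleR_regular_operator.rep_eq
        scaleR_left_mono)
  show "a *\<^sub>R S \<le> b *\<^sub>R S" if "a \<le> b" "0 \<le> S"
    using that by (simp add: less_eq_regular_operator_def scaleR_regular_operator.rep_eq
        zero_regular_operator.rep_eq scaleR_right_mono)
qed

end

text \<open>\<open>regular_operators_into W\<close> is the space of regular operators from \<open>E\<close> into the ordered vector
  subspace \<open>W\<close> of \<open>G\<close>: both positive parts take their values in \<open>W\<close>.\<close>

definition regular_operators_into ::
    "'g::riesz_space set \<Rightarrow> ('e::riesz_space, 'g) regular_operator set" where
  "regular_operators_into W = {T. \<exists>P Q. positive_operator P \<and> positive_operator Q \<and>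
     range P \<subseteq> W \<and> range Q \<subseteq> W \<and> app T = (\<lambda>x. P x - Q x)}"

text \<open>Composition is meaningful for positive linear \<open>i\<close>; see \<open>app_compose_left\<close>.\<close>

definition compose_left :: "('f::riesz_space \<Rightarrow> 'g::riesz_space) \<Rightarrow>
    ('e::riesz_space, 'f) regular_operator \<Rightarrow> ('e, 'g) regular_operator" where
  "compose_left i T = Regular_operator (i \<circ> app T)"

lemma app_compose_left:
  assumes "linear i" "bipositive i"
  shows "app (compose_left i T) = i \<circ> app T"
proof -
  obtain P Q where PQ: "positive_operator P" "positive_operator Q" "app T = (\<lambda>x. P x - Q x)"
    using app[of T] by blast
  have "positive_operator (i \<circ> P)" "positive_operator (i \<circ> Q)"
    using assms PQ by (auto simp: positive_operator_def bipositive_def intro: linear_compose)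
  moreover have "i \<circ> app T = (\<lambda>x. (i \<circ> P) x - (i \<circ> Q) x)"
    using PQ(3) assms(1) by (simp add: fun_eq_iff linear_diff)
  ultimately show ?thesis
    unfolding compose_left_def by (intro Regular_operator_inverse) blast
qed

lemma regular_operators_into_range:
  fixes i :: "'f::riesz_space \<Rightarrow> 'g::riesz_space"
  assumes i: "linear i" "bipositive i"
  shows "(regular_operators_into (range i) :: ('e::riesz_space, 'g) regular_operator set) =
    range (compose_left i)"
proof (intro equalityI subsetI)
  fix T :: "('e, 'g) regular_operator"
  assume "T \<in> regular_operators_into (range i)"
  then obtain P Q where PQ: "positive_operator P" "positive_operator Q" "range P \<subseteq> range i"
    "range Q \<subseteq> range i" "app T = (\<lambda>x. P x - Q x)"
    unfolding regular_operators_into_def by blast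
  have "inj i"
  proof (rule injI)
    fix x y assume "i x = i y"
    then have "0 \<le> i (x - y)" "0 \<le> i (y - x)" by (simp_all add: linear_diff[OF i(1)])
    then have "0 \<le> x - y" "0 \<le> y - x" using i(2) unfolding bipositive_def by blast+
    then show "x = y" by simp
  qed
  have factor: "\<exists>P'. positive_operator P' \<and> R = i \<circ> P'"
    if R: "positive_operator R" "range R \<subseteq> range i" for R :: "'e \<Rightarrow> 'g"
  proof -
    define P' where "P' x = inv i (R x)" for x
    have iP: "i (P' x) = R x" for x
      using R(2) unfolding P'_def by (simp add: f_inv_into_f range_subsetD)
    have "linear P'"
    proof (rule linearI)
      fix x y c
      have "i (P' (x + y)) = i (P' x + P' y)" "i (P' (c *\<^sub>R x)) = i (c *\<^sub>R P' x)"
        using R(1) i(1) unfolding positive_operator_def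
        by (simp_all add: iP linear_add linear_scale)
      then show "P' (x + y) = P' x + P' y" "P' (c *\<^sub>R x) = c *\<^sub>R P' x"
        using \<open>inj i\<close> by (blast dest: injD)+
    qed
    moreover have "0 \<le> P' x" if "0 \<le> x" for x
      using that R(1) i(2) iP[of x] unfolding positive_operator_def bipositive_def by metis
    moreover have "R = i \<circ> P'" by (simp add: fun_eq_iff iP)
    ultimately show ?thesis unfolding positive_operator_def by blast
  qed
  obtain P' Q' where P': "positive_operator P'" "P = i \<circ> P'" "positive_operator Q'" "Q = i \<circ> Q'"
    using factor PQ by metis
  define T' where "T' = Regular_operator (\<lambda>x. P' x - Q' x)"
  have "app T' = (\<lambda>x. P' x - Q' x)"
    unfolding T'_def by (intro Regular_operator_inverse) (use P' in blast)
  then have "app (compose_left i T') = app T"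
    using P' PQ(5) i(1) by (simp add: app_compose_left[OF i] fun_eq_iff linear_diff)
  then show "T \<in> range (compose_left i)" by (metis app_inject rangeI)
next
  fix T :: "('e, 'g) regular_operator"
  assume "T \<in> range (compose_left i)"
  then obtain S where S: "T = compose_left i S" by blast
  obtain P Q where PQ: "positive_operator P" "positive_operator Q" "app S = (\<lambda>x. P x - Q x)"
    using app[of S] by blast
  have "positive_operator (i \<circ> P)" "positive_operator (i \<circ> Q)"
    using i PQ by (auto simp: positive_operator_def bipositive_def intro: linear_compose)
  moreover have "app T = (\<lambda>x. (i \<circ> P) x - (i \<circ> Q) x)"
    using PQ(3) i(1) S by (simp add: app_compose_left[OF i] fun_eq_iff linear_diff)
  moreover have "range (i \<circ> P) \<subseteq> range i" "range (i \<circ> Q) \<subseteq> range i" by auto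
  ultimately show "T \<in> regular_operators_into (range i)"
    unfolding regular_operators_into_def by blast
qed

definition riesz_kantorovich_property ::
    "('e::riesz_space, 'f::riesz_space) regular_operator itself \<Rightarrow> bool" where
  "riesz_kantorovich_property _ \<longleftrightarrow>
     (\<forall>(T :: ('e, 'f) regular_operator) P. isLub UNIV {T, 0} P \<longrightarrow>
        (\<forall>x\<ge>0. isLub UNIV {app T y | y. 0 \<le> y \<and> y \<le> x} (app P x)))"

end

theory Submission
  imports Defs
begin

text \<open>Write \<open>J\<close> for composition with \<open>i\<close>, from the operators into \<open>F\<close> to the operators into the order
  completion of \<open>F\<close>. By the Riesz-Kantorovich theorem the latter form an Archimedean vector lattice,
  in which the range of \<open>J\<close> is pervasive. All three assertions are transferred from this lattice.

  The link is density. In an Archimedean vector lattice a pervasive subspace that bounds \<open>x\<close> from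
  below (above) has \<open>x\<close> as the supremum (infimum) of its elements below (above) \<open>x\<close>
  (\<open>isLub_of_pervasive\<close>, \<open>isGlb_of_pervasive\<close>). Every element of the Riesz subspace generated by a
  directed subspace is bounded on both sides by elements of that subspace, which gives the Riesz
  completion (\<open>riesz_completion_hull\<close>). Density also makes \<open>J\<close> preserve existing suprema
  (\<open>join_embedding\<close>), which gives the Riesz-Kantorovich property, and preserve and reflect disjointness
  (\<open>po_disjoint_embedding\<close>).

  For the band property, \<open>T\<close> is order continuous iff the modulus of \<open>J T\<close> maps sets decreasing to
  \<open>0\<close> to such sets (\<open>order_continuous_iff_normal\<close>); the essential part is Ogasawara's theorem that the
  positive part of an order continuous operator is order continuous (\<open>normal_positive_part\<close>). Below
  every positive operator there is a greatest normal one (\<open>greatest_normal_below\<close>). If \<open>T\<close> lies in the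
  second disjoint complement of the order continuous operators, then the part of \<open>\<bar>J T\<bar>\<close> that remains
  after subtracting its greatest normal minorant must vanish: otherwise it would dominate some
  \<open>J z > 0\<close>, with \<open>z\<close> disjoint from all order continuous operators and hence from \<open>T\<close>.\<close>

section \<open>Disjointness in lattice-ordered groups\<close>

context lattice_ab_group_add
begin

text \<open>The difference \<open>d - inf a d = sup (d - a) 0\<close> increases with \<open>d\<close>. Comparing its value at
  \<open>t = sup b c\<close> with those at \<open>b\<close> and \<open>c\<close> bounds both \<open>b\<close> and \<open>c\<close>, hence \<open>t\<close>, by
  \<open>t - inf a t + s\<close>, where \<open>s\<close> is the right-hand side.\<close>
lemma lattice_group_inf_sup_distrib: "inf a (sup b c) = sup (inf a b) (inf a c)"
proof (rule order.antisym)
  define s where "s = sup (inf a b) (inf a c)"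
  define t where "t = sup b c"
  have bound: "d \<le> t + s - inf a t" if "d \<le> t" "inf a d \<le> s" for d
  proof -
    have "d - inf a d = d + sup (- a) (- d)" by (rule diff_inf_eq_sup)
    also have "\<dots> = sup (d - a) 0" by (simp add: add_sup_distrib_left)
    also have "\<dots> \<le> sup (t - a) 0" using that(1) by (intro sup_mono diff_right_mono order_refl)
    also have "\<dots> = t + sup (- a) (- t)" by (simp add: add_sup_distrib_left)
    also have "\<dots> = t - inf a t" by (rule diff_inf_eq_sup[symmetric])
    finally have "d \<le> t - inf a t + inf a d" by (simp only: diff_le_eq)
    also have "\<dots> \<le> t - inf a t + s" using that(2) by (rule add_left_mono)
    finally show ?thesis by (simp add: algebra_simps)
  qed
  have "t \<le> t + s - inf a t"
    unfolding t_def by (rule sup_least) (rule bound[unfolded t_def]; simp add: s_def)+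
  then have "t + inf a t \<le> t + s" by (simp only: le_diff_eq)
  then show "inf a (sup b c) \<le> sup (inf a b) (inf a c)"
    unfolding t_def s_def by (simp only: add_le_cancel_left)
next
  show "sup (inf a b) (inf a c) \<le> inf a (sup b c)"
    by (meson inf_greatest inf_le1 inf_le2 le_supI sup_ge1 sup_ge2 order_trans)
qed

lemma lattice_group_inf_sup_distrib2: "inf (sup b c) a = sup (inf b a) (inf c a)"
  by (simp add: inf_commute lattice_group_inf_sup_distrib)

end

context lattice_ab_group_add_abs
begin

lemma sup_abs_add_abs_diff: "sup \<bar>x + y\<bar> \<bar>x - y\<bar> = \<bar>x\<bar> + \<bar>y\<bar>"
proof (rule order.antisym)
  show "sup \<bar>x + y\<bar> \<bar>x - y\<bar> \<le> \<bar>x\<bar> + \<bar>y\<bar>"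
    by (simp add: abs_triangle_ineq abs_triangle_ineq4)
next
  define v where "v = sup \<bar>x + y\<bar> \<bar>x - y\<bar>"
  have "\<bar>x + y\<bar> \<le> v" "\<bar>x - y\<bar> \<le> v" by (simp_all add: v_def)
  then have "x + y \<le> v" "- (x + y) \<le> v" "x - y \<le> v" "- (x - y) \<le> v"
    by (auto dest: abs_le_D1 abs_le_D2)
  then have "y + x \<le> v" "- y + x \<le> v" "y - x \<le> v" "- y - x \<le> v"
    by (simp_all only: minus_add_distrib diff_conv_add_uminus minus_minus add.commute)
  then have "y \<le> v - x" "- y \<le> v - x" "y \<le> v + x" "- y \<le> v + x"
    by (simp_all only: diff_le_eq le_diff_eq)
  then have "\<bar>y\<bar> \<le> v - x" "\<bar>y\<bar> \<le> v + x"
    by (blast intro: abs_leI)+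
  then have "x \<le> v - \<bar>y\<bar>" "- x \<le> v - \<bar>y\<bar>"
    by (simp_all add: algebra_simps)
  then have "\<bar>x\<bar> \<le> v - \<bar>y\<bar>" by (rule abs_leI)
  then show "\<bar>x\<bar> + \<bar>y\<bar> \<le> sup \<bar>x + y\<bar> \<bar>x - y\<bar>"
    unfolding v_def by (simp add: algebra_simps)
qed

lemma inf_abs_add_abs_diff: "inf \<bar>x + y\<bar> \<bar>x - y\<bar> = \<bar>\<bar>x\<bar> - \<bar>y\<bar>\<bar>"
proof -
  have inf_pm: "inf (a + b) (a - b) = a - \<bar>b\<bar>" for a b
    by (simp add: abs_lattice diff_sup_eq_inf add_inf_distrib_left inf_commute)
  have sup_pm: "sup (a + c) (- a + c) = \<bar>a\<bar> + c" for a c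
    by (simp add: abs_lattice add_sup_distrib_right)
  have "inf \<bar>x + y\<bar> \<bar>x - y\<bar> =
      sup (sup (inf (x + y) (x - y)) (inf (x + y) (- (x - y))))
          (sup (inf (- (x + y)) (x - y)) (inf (- (x + y)) (- (x - y))))"
    unfolding abs_lattice[of "x + y"] abs_lattice[of "x - y"]
    by (simp only: lattice_group_inf_sup_distrib lattice_group_inf_sup_distrib2 sup_aci)
  also have "inf (x + y) (x - y) = x - \<bar>y\<bar>" by (rule inf_pm)
  also have "inf (x + y) (- (x - y)) = y - \<bar>x\<bar>" using inf_pm[of y x] by (simp add: add.commute)
  also have "inf (- (x + y)) (x - y) = - y - \<bar>x\<bar>"
    using inf_pm[of "- y" x]
    by (simp only: minus_add_distrib inf_commute diff_conv_add_uminus add.commute minus_minus)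
  also have "inf (- (x + y)) (- (x - y)) = - x - \<bar>y\<bar>"
    using inf_pm[of "- x" y]
    by (simp only: minus_add_distrib inf_commute diff_conv_add_uminus add.commute minus_minus)
  also have "sup (sup (x - \<bar>y\<bar>) (y - \<bar>x\<bar>)) (sup (- y - \<bar>x\<bar>) (- x - \<bar>y\<bar>)) =
      sup (sup (x - \<bar>y\<bar>) (- x - \<bar>y\<bar>)) (sup (y - \<bar>x\<bar>) (- y - \<bar>x\<bar>))"
    by (simp add: sup_aci)
  also have "\<dots> = sup (\<bar>x\<bar> - \<bar>y\<bar>) (\<bar>y\<bar> - \<bar>x\<bar>)"
    using sup_pm[of x "- \<bar>y\<bar>"] sup_pm[of y "- \<bar>x\<bar>"] by simp
  also have "\<dots> = \<bar>\<bar>x\<bar> - \<bar>y\<bar>\<bar>" by (simp add: abs_lattice[of "\<bar>x\<bar> - \<bar>y\<bar>"])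
  finally show ?thesis .
qed

text \<open>Two elements agree iff their supremum is below their infimum, so by the previous two identities
  the left-hand side says \<open>\<bar>x\<bar> + \<bar>y\<bar> = \<bar>\<bar>x\<bar> - \<bar>y\<bar>\<bar>\<close>; the two members of this equation differ by twice
  \<open>inf \<bar>x\<bar> \<bar>y\<bar>\<close>. This connects the disjointness of partially ordered vector spaces, which speaks of
  upper bounds only, with the lattice notion.\<close>
lemma abs_add_eq_abs_diff_iff: "\<bar>x + y\<bar> = \<bar>x - y\<bar> \<longleftrightarrow> inf \<bar>x\<bar> \<bar>y\<bar> = 0"
proof
  assume "\<bar>x + y\<bar> = \<bar>x - y\<bar>"
  then have eq: "\<bar>x\<bar> + \<bar>y\<bar> = \<bar>\<bar>x\<bar> - \<bar>y\<bar>\<bar>"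
    using sup_abs_add_abs_diff[of x y] inf_abs_add_abs_diff[of x y] by simp
  define m where "m = inf \<bar>x\<bar> \<bar>y\<bar>"
  have m: "0 \<le> m" "m \<le> \<bar>x\<bar>" "m \<le> \<bar>y\<bar>" by (simp_all add: m_def)
  have "\<bar>\<bar>x\<bar> - \<bar>y\<bar>\<bar> \<le> \<bar>x\<bar> + \<bar>y\<bar> - (m + m)"
  proof (rule abs_leI)
    have "m + m \<le> \<bar>y\<bar> + \<bar>y\<bar>" "m + m \<le> \<bar>x\<bar> + \<bar>x\<bar>" using m by (simp_all add: add_mono)
    from add_left_mono[OF this(1), of "\<bar>x\<bar> - \<bar>y\<bar>"] add_left_mono[OF this(2), of "\<bar>y\<bar> - \<bar>x\<bar>"]
    show "\<bar>x\<bar> - \<bar>y\<bar> \<le> \<bar>x\<bar> + \<bar>y\<bar> - (m + m)" "- (\<bar>x\<bar> - \<bar>y\<bar>) \<le> \<bar>x\<bar> + \<bar>y\<bar> - (m + m)"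
      by (simp_all add: algebra_simps)
  qed
  then have "(\<bar>x\<bar> + \<bar>y\<bar>) + (m + m) \<le> (\<bar>x\<bar> + \<bar>y\<bar>) + 0"
    unfolding eq[symmetric] by (simp only: le_diff_eq add_0_right)
  then have "m + m \<le> 0" by (simp only: add_le_cancel_left)
  then have "m \<le> 0" by simp
  then show "inf \<bar>x\<bar> \<bar>y\<bar> = 0" using m(1) unfolding m_def by (rule order.antisym)
next
  assume disj: "inf \<bar>x\<bar> \<bar>y\<bar> = 0"
  define w where "w = \<bar>\<bar>x\<bar> - \<bar>y\<bar>\<bar>"
  have w: "0 \<le> w" "\<bar>x\<bar> - \<bar>y\<bar> \<le> w" "- (\<bar>x\<bar> - \<bar>y\<bar>) \<le> w"
    using abs_ge_self[of "\<bar>x\<bar> - \<bar>y\<bar>"] abs_ge_minus_self[of "\<bar>x\<bar> - \<bar>y\<bar>"] by (simp_all add: w_def)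
  have "\<bar>x\<bar> - w \<le> (inf \<bar>x\<bar> \<bar>y\<bar>)" "\<bar>y\<bar> - w \<le> (inf \<bar>x\<bar> \<bar>y\<bar>)"
    using w by (simp_all add: algebra_simps)
  then have "sup \<bar>x\<bar> \<bar>y\<bar> \<le> w" unfolding disj by simp
  then have "\<bar>x\<bar> + \<bar>y\<bar> \<le> w" using add_eq_inf_sup[of "\<bar>x\<bar>" "\<bar>y\<bar>"] disj by simp
  then have "sup \<bar>x + y\<bar> \<bar>x - y\<bar> \<le> inf \<bar>x + y\<bar> \<bar>x - y\<bar>"
    unfolding sup_abs_add_abs_diff inf_abs_add_abs_diff w_def .
  then show "\<bar>x + y\<bar> = \<bar>x - y\<bar>"
    by (meson inf_le1 inf_le2 order.antisym order.trans sup_ge1 sup_ge2)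
qed

end

section \<open>Pervasive subspaces of Archimedean vector lattices\<close>

lemma isLub_UNIV_iff:
  "isLub UNIV A s \<longleftrightarrow> (\<forall>a\<in>A. a \<le> s) \<and> (\<forall>u. (\<forall>a\<in>A. a \<le> u) \<longrightarrow> s \<le> u)"
  by (auto simp: isLub_def leastP_def isUb_def setle_def setge_def)

lemma isGlb_UNIV_iff:
  "isGlb UNIV A s \<longleftrightarrow> (\<forall>a\<in>A. s \<le> a) \<and> (\<forall>l. (\<forall>a\<in>A. l \<le> a) \<longrightarrow> l \<le> s)"
  by (auto simp: isGlb_def greatestP_def isLb_def setle_def setge_def)

lemma isLub_UNIV_unique: "isLub UNIV A s \<Longrightarrow> isLub UNIV A t \<Longrightarrow> s = (t::'a::order)"
  by (simp add: isLub_UNIV_iff order.antisym)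

lemma isGlb_UNIV_unique: "isGlb UNIV A s \<Longrightarrow> isGlb UNIV A t \<Longrightarrow> s = (t::'a::order)"
  by (simp add: isGlb_UNIV_iff order.antisym)

lemma isLub_restrict: "isLub UNIV A s \<Longrightarrow> s \<in> X \<Longrightarrow> isLub X A s"
  by (auto simp: isLub_def leastP_def isUb_def setle_def setge_def)

lemma isGlb_restrict: "isGlb UNIV A s \<Longrightarrow> s \<in> X \<Longrightarrow> isGlb X A s"
  by (auto simp: isGlb_def greatestP_def isLb_def setle_def setge_def)

lemma isGlb_uminus_iff:
  fixes A :: "'a::ordered_ab_group_add set"
  shows "isGlb UNIV A t \<longleftrightarrow> isLub UNIV (uminus ` A) (- t)"
proof -
  have "(\<forall>u. (\<forall>a\<in>A. - a \<le> u) \<longrightarrow> - t \<le> u) \<longleftrightarrow> (\<forall>l. (\<forall>a\<in>A. l \<le> a) \<longrightarrow> l \<le> t)"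
    by (metis neg_le_iff_le minus_minus)
  then show ?thesis by (simp add: isLub_UNIV_iff isGlb_UNIV_iff)
qed

text \<open>Spaces of regular operators are lattices only under a hypothesis on the codomain, so they
  cannot be instances of a lattice class. The lattice operations are therefore defined from the
  suprema that are assumed to exist, and the theory of lattice-ordered groups is interpreted.\<close>
locale vector_lattice =
  fixes type :: "'m::ordered_real_vector itself"
  assumes ex_lub: "\<And>x y::'m. \<exists>s. isLub UNIV {x, y} s"
begin

definition join :: "'m \<Rightarrow> 'm \<Rightarrow> 'm" where "join x y = (THE s. isLub UNIV {x, y} s)"

definition meet :: "'m \<Rightarrow> 'm \<Rightarrow> 'm" where "meet x y = - join (- x) (- y)"

definition modulus :: "'m \<Rightarrow> 'm" where "modulus x = join x (- x)"

lemma isLub_join: "isLub UNIV {x, y} (join x y)"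
proof -
  obtain s where s: "isLub UNIV {x, y} s" using ex_lub by blast
  then show ?thesis unfolding join_def by (rule theI) (rule isLub_UNIV_unique[OF _ s])
qed

lemma isGlb_meet: "isGlb UNIV {x, y} (meet x y)"
  unfolding isGlb_uminus_iff meet_def using isLub_join[of "- x" "- y"] by simp

sublocale lat: lattice_ab_group_add_abs modulus "(+)" "0::'m" "(-)" uminus "(\<le>)" "(<)" meet join
proof unfold_locales
  fix x y z :: 'm
  show "x \<le> join x y" "y \<le> join x y" "y \<le> x \<Longrightarrow> z \<le> x \<Longrightarrow> join y z \<le> x"
    using isLub_join[of x y] isLub_join[of y z] by (auto simp: isLub_UNIV_iff)
  show "meet x y \<le> x" "meet x y \<le> y" "x \<le> y \<Longrightarrow> x \<le> z \<Longrightarrow> x \<le> meet y z"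
    using isGlb_meet[of x y] isGlb_meet[of y z] by (auto simp: isGlb_UNIV_iff)
  show "modulus x = join x (- x)" by (rule modulus_def)
qed

lemma ubs_plus_minus: "ubs UNIV {x, - x} = {modulus x..}"
  by (auto simp: ubs_def isUb_def setle_def lat.abs_le_iff)

lemma po_disjoint_iff: "po_disjoint x y \<longleftrightarrow> meet (modulus x) (modulus y) = 0"
proof -
  have "po_disjoint x y \<longleftrightarrow> {modulus (x + y)..} = {modulus (x - y)..}"
    using ubs_plus_minus[of "x + y"] ubs_plus_minus[of "x - y"] by (simp add: po_disjoint_def)
  also have "\<dots> \<longleftrightarrow> modulus (x + y) = modulus (x - y)" by (simp add: set_eq_iff) (metis order.antisym order.refl)
  finally show ?thesis by (simp only: lat.abs_add_eq_abs_diff_iff)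
qed

end

lemma bipositive_le_iff:
  fixes j :: "'v::ordered_real_vector \<Rightarrow> 'm::ordered_real_vector"
  assumes "linear j" "bipositive j"
  shows "j x \<le> j y \<longleftrightarrow> x \<le> y"
proof -
  have "0 \<le> j (y - x) \<longleftrightarrow> 0 \<le> y - x" using assms(2) by (simp add: bipositive_def)
  then show ?thesis by (simp add: linear_diff[OF assms(1)])
qed

lemma bipositive_archimedean:
  fixes j :: "'v::ordered_real_vector \<Rightarrow> 'm::ordered_real_vector"
  assumes j: "linear j" "bipositive j" and arch: "archimedean_on (UNIV :: 'm set)"
  shows "archimedean_on (UNIV :: 'v set)"
  unfolding archimedean_on_def
proof (intro ballI impI)
  fix x y :: 'v
  assume "\<forall>n::nat. 0 < n \<longrightarrow> real n *\<^sub>R x \<le> y"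
  then have "\<forall>n::nat. 0 < n \<longrightarrow> real n *\<^sub>R j x \<le> j y"
    by (simp add: bipositive_le_iff[OF j] flip: linear_scale[OF j(1)])
  then have "j x \<le> j 0"
    using arch unfolding archimedean_on_def linear_0[OF j(1)] by blast
  then show "x \<le> 0" by (simp only: bipositive_le_iff[OF j])
qed

lemma po_disjoint_iff_bounds:
  "po_disjoint x y \<longleftrightarrow>
     (\<forall>u. (x + y \<le> u \<and> - x - y \<le> u) \<longleftrightarrow> (x - y \<le> u \<and> - x + y \<le> u))"
  by (simp add: po_disjoint_def ubs_def isUb_def setle_def set_eq_iff)

lemma po_disjoint_commute: "po_disjoint x y \<longleftrightarrow> po_disjoint y (x :: 'a::ordered_real_vector)"
proof -
  have "y + x = x + y" "- y - x = - x - y" "y - x = - x + y" "- y + x = x - y" by simp_all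
  then show ?thesis unfolding po_disjoint_iff_bounds by (simp only:) blast
qed

locale archimedean_vector_lattice = vector_lattice type
  for type :: "'m::ordered_real_vector itself" +
  assumes archimedean: "archimedean_on (UNIV :: 'm set)"
begin

text \<open>Let \<open>z\<close> be the infimum of \<open>x\<close> and another upper bound. If \<open>z < x\<close>, pervasiveness gives
  \<open>0 < y \<le> x - z\<close> with \<open>y \<in> Y\<close>, and then \<open>w + n y\<close> stays below \<open>x\<close> for all \<open>n\<close>, which the Archimedean
  property forbids. Some element \<open>w\<close> of \<open>Y\<close> below \<open>x\<close> must be given to start with.\<close>
lemma isLub_of_pervasive:
  fixes x :: 'm
  assumes Y: "subspace Y" "pervasive_in Y UNIV" and w: "w \<in> Y" "w \<le> x"
  shows "isLub UNIV {y \<in> Y. y \<le> x} x"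
  unfolding isLub_UNIV_iff
proof (intro conjI allI impI)
  show "\<forall>a\<in>{y \<in> Y. y \<le> x}. a \<le> x" by simp
next
  fix u assume u: "\<forall>y\<in>{y \<in> Y. y \<le> x}. y \<le> u"
  define z where "z = meet u x"
  have z: "y \<le> z" if "y \<in> Y" "y \<le> x" for y
    using that u unfolding z_def by simp
  have "z \<le> u" "z \<le> x" by (simp_all add: z_def)
  show "x \<le> u"
  proof (rule ccontr)
    assume "\<not> x \<le> u"
    then have "0 < x - z" using \<open>z \<le> u\<close> \<open>z \<le> x\<close> by (auto simp: order_less_le)
    then obtain y where y: "y \<in> Y" "0 < y" "y \<le> x - z"
      using Y(2) unfolding pervasive_in_def by blast
    \<comment> \<open>An element of \<open>Y\<close> below \<open>x\<close> is below \<open>z\<close>, so adding \<open>y \<le> x - z\<close> keeps it below \<open>x\<close>.\<close>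
    have step: "w + real n *\<^sub>R y \<in> Y \<and> w + real n *\<^sub>R y \<le> x" for n
    proof (induction n)
      case 0
      then show ?case using w by simp
    next
      case (Suc n)
      have "w + real n *\<^sub>R y \<le> z" using Suc z by blast
      then have "(w + real n *\<^sub>R y) + y \<le> z + (x - z)" using y(3) by (rule add_mono)
      moreover have "(w + real n *\<^sub>R y) + y \<in> Y"
        using Suc subspace_add[OF Y(1) _ y(1)] by blast
      moreover have "(w + real n *\<^sub>R y) + y = w + real (Suc n) *\<^sub>R y"
        by (simp add: algebra_simps)
      ultimately show ?case by (simp only: add_diff_cancel_left' add.commute[of z] diff_add_cancel)
    qed
    then have "\<forall>n::nat. 0 < n \<longrightarrow> real n *\<^sub>R y \<le> x - w" by (simp add: algebra_simps)
    then have "y \<le> 0" using archimedean unfolding archimedean_on_def by blast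
    then show False using y(2) by simp
  qed
qed

lemma isGlb_of_pervasive:
  fixes x :: 'm
  assumes Y: "subspace Y" "pervasive_in Y UNIV" and w: "w \<in> Y" "x \<le> w"
  shows "isGlb UNIV {y \<in> Y. x \<le> y} x"
proof -
  have "- y \<in> Y \<longleftrightarrow> y \<in> Y" for y using subspace_neg[OF Y(1)] by (metis minus_minus)
  then have "uminus ` {y \<in> Y. x \<le> y} = {y \<in> Y. y \<le> - x}"
    by (auto simp: image_iff le_minus_iff) (metis minus_le_iff minus_minus)
  moreover have "isLub UNIV {y \<in> Y. y \<le> - x} (- x)"
    using w by (intro isLub_of_pervasive[OF Y subspace_neg[OF Y(1) w(1)]]) simp
  ultimately show ?thesis by (simp add: isGlb_uminus_iff)
qed

lemma riesz_subspace_iff: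
  "riesz_subspace UNIV Z \<longleftrightarrow> subspace Z \<and> (\<forall>x\<in>Z. \<forall>y\<in>Z. join x y \<in> Z \<and> meet x (y::'m) \<in> Z)"
proof -
  have "(\<exists>s\<in>Z. isLub UNIV {x, y} s) \<longleftrightarrow> join x y \<in> Z" "(\<exists>s\<in>Z. isGlb UNIV {x, y} s) \<longleftrightarrow> meet x y \<in> Z" for x y
    using isLub_join isLub_UNIV_unique isGlb_meet isGlb_UNIV_unique by metis+
  then show ?thesis unfolding riesz_subspace_def by simp
qed

lemma riesz_subspace_UNIV_hull: "riesz_subspace UNIV (riesz_subspace UNIV hull (A :: 'm set))"
  by (rule hull_in) (auto simp: riesz_subspace_iff intro: subspace_Inter)

end

text \<open>This situation occurs twice: for the given embedding of \<open>F\<close> into its order completion, and for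
  composition with it, between the two spaces of operators.\<close>
locale pervasive_embedding = archimedean_vector_lattice type
  for type :: "'m::ordered_real_vector itself" +
  fixes j :: "'v::ordered_real_vector \<Rightarrow> 'm"
  assumes linear_j: "linear j" and bipositive_j: "bipositive j"
    and pervasive_range: "pervasive_in (range j) UNIV"
    and directed_domain: "directed_on (UNIV :: 'v set)"
begin

lemmas le_iff = bipositive_le_iff[OF linear_j bipositive_j]

lemma subspace_range: "subspace (range j)"
  using linear_subspace_image[OF linear_j subspace_UNIV] .

lemma upper_bound: obtains u :: 'v where "x \<le> u" "y \<le> u"
  using directed_domain unfolding directed_on_def by blast

lemma isLub_below: "j v \<le> x \<Longrightarrow> isLub UNIV {y \<in> range j. y \<le> x} x"
  by (rule isLub_of_pervasive[OF subspace_range pervasive_range rangeI])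

lemma isGlb_above: "x \<le> j v \<Longrightarrow> isGlb UNIV {y \<in> range j. x \<le> y} x"
  by (rule isGlb_of_pervasive[OF subspace_range pervasive_range rangeI])

text \<open>The form in which density is applied: to show \<open>y \<le> x\<close> it suffices to compare with the elements
  of the range above \<open>x\<close>, as soon as there is one.\<close>
lemma greatest_below_range:
  assumes "x \<le> j v" and "\<And>u. x \<le> j u \<Longrightarrow> y \<le> j u"
  shows "y \<le> x"
  using isGlb_above[OF assms(1)] assms(2) unfolding isGlb_UNIV_iff by blast

lemma join_embedding:
  assumes "isLub UNIV {v, w} p"
  shows "join (j v) (j w) = j p"
proof (rule order.antisym)
  show "join (j v) (j w) \<le> j p" using assms by (simp add: isLub_UNIV_iff le_iff)
  then show "j p \<le> join (j v) (j w)"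
  proof (rule greatest_below_range)
    fix u assume "join (j v) (j w) \<le> j u"
    then show "j p \<le> j u" using assms by (simp add: isLub_UNIV_iff le_iff)
  qed
qed

text \<open>Disjointness of \<open>j x\<close> and \<open>j y\<close> means that \<open>j (x + y)\<close> and \<open>j (x - y)\<close> have the same modulus.
  By density a modulus is the infimum of the elements \<open>j u\<close> above it, so it is determined by the
  upper bounds \<open>u\<close> that disjointness of \<open>x\<close> and \<open>y\<close> speaks of.\<close>
lemma po_disjoint_embedding: "po_disjoint (j x) (j y) \<longleftrightarrow> po_disjoint x y"
proof
  assume "po_disjoint (j x) (j y)"
  then have "(j x + j y \<le> j u \<and> - j x - j y \<le> j u) \<longleftrightarrow> (j x - j y \<le> j u \<and> - j x + j y \<le> j u)" for u
    unfolding po_disjoint_iff_bounds by blast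
  then show "po_disjoint x y"
    unfolding po_disjoint_iff_bounds
    by (simp only: le_iff linear_add[OF linear_j, symmetric] linear_diff[OF linear_j, symmetric]
        linear_neg[OF linear_j, symmetric]) blast
next
  assume "po_disjoint x y"
  then have same: "(x + y \<le> u \<and> - x - y \<le> u) \<longleftrightarrow> (x - y \<le> u \<and> - x + y \<le> u)" for u
    unfolding po_disjoint_iff_bounds by blast
  have bound: "modulus (j a) \<le> j u \<longleftrightarrow> a \<le> u \<and> - a \<le> u" for a u
    by (simp add: lat.abs_le_iff le_iff flip: linear_neg[OF linear_j])
  have eq: "modulus (j (x + y)) \<le> j u \<longleftrightarrow> modulus (j (x - y)) \<le> j u" for u
    using same[of u] unfolding bound by (simp add: algebra_simps)
  obtain u where "x + y \<le> u" "- (x + y) \<le> u" by (rule upper_bound)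
  then have u: "modulus (j (x + y)) \<le> j u" by (simp add: bound)
  have "modulus (j (x + y)) = modulus (j (x - y))"
    by (rule order.antisym) (use u eq in \<open>blast intro: greatest_below_range\<close>)+
  then show "po_disjoint (j x) (j y)"
    unfolding po_disjoint_iff lat.abs_add_eq_abs_diff_iff[symmetric]
    by (simp add: linear_add[OF linear_j] linear_diff[OF linear_j])
qed

text \<open>The order ideal generated by the range. It is a Riesz subspace, and so it contains the hull; this
  supplies the bounds in the range that density needs.\<close>
lemma riesz_subspace_generated_ideal: "riesz_subspace UNIV {x. \<exists>v. - j v \<le> x \<and> x \<le> j v}"
  unfolding riesz_subspace_iff
proof (intro conjI ballI)
  let ?I = "{x. \<exists>v. - j v \<le> x \<and> x \<le> j v}"
  show "subspace ?I"
    unfolding subspace_def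
  proof (intro conjI ballI allI)
    show "0 \<in> ?I" using linear_0[OF linear_j] by (auto intro!: exI[of _ 0])
    fix x assume "x \<in> ?I"
    then obtain v where v: "- j v \<le> x" "x \<le> j v" by blast
    show "x + y \<in> ?I" if "y \<in> ?I" for y
    proof -
      from that obtain w where w: "- j w \<le> y" "y \<le> j w" by blast
      have "- j (v + w) \<le> x + y" "x + y \<le> j (v + w)"
        using add_mono[OF v(1) w(1)] add_mono[OF v(2) w(2)] by (simp_all add: linear_add[OF linear_j])
      then show ?thesis by blast
    qed
    show "c *\<^sub>R x \<in> ?I" for c
    proof (cases "0 \<le> c")
      case True
      then have "- j (c *\<^sub>R v) \<le> c *\<^sub>R x" "c *\<^sub>R x \<le> j (c *\<^sub>R v)"
        using scaleR_left_mono[OF v(1), of c] scaleR_left_mono[OF v(2), of c]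
        by (simp_all add: linear_scale[OF linear_j])
      then show ?thesis by blast
    next
      case False
      then have "- j ((- c) *\<^sub>R v) \<le> c *\<^sub>R x" "c *\<^sub>R x \<le> j ((- c) *\<^sub>R v)"
        using scaleR_left_mono[OF v(1), of "- c"] scaleR_left_mono[OF v(2), of "- c"]
        by (simp_all add: linear_scale[OF linear_j] linear_neg[OF linear_j] minus_le_iff le_minus_iff)
      then show ?thesis by blast
    qed
  qed
  fix x y assume "x \<in> ?I" "y \<in> ?I"
  then obtain v w where vw: "- j v \<le> x" "x \<le> j v" "- j w \<le> y" "y \<le> j w" by blast
  obtain u where "v \<le> u" "w \<le> u" by (rule upper_bound)
  then have "j v \<le> j u" "j w \<le> j u" "- j u \<le> - j v" "- j u \<le> - j w" by (simp_all add: le_iff)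
  then have u: "- j u \<le> x" "x \<le> j u" "- j u \<le> y" "y \<le> j u"
    using vw by (blast intro: order_trans)+
  then have "- j u \<le> join x y \<and> join x y \<le> j u" "- j u \<le> meet x y \<and> meet x y \<le> j u"
    by (simp_all add: lat.le_supI1 lat.le_infI1)
  then show "join x y \<in> ?I" "meet x y \<in> ?I" by blast+
qed

lemma hull_majorized:
  assumes "x \<in> riesz_subspace UNIV hull range j"
  obtains v where "- j v \<le> x" "x \<le> j v"
proof -
  have "range j \<subseteq> {x. \<exists>v. - j v \<le> x \<and> x \<le> j v}"
  proof
    fix x assume "x \<in> range j"
    then obtain a where a: "x = j a" by blast
    obtain u where "a \<le> u" "- a \<le> u" by (rule upper_bound)
    then have "j a \<le> j u" "- j u \<le> j a"
      by (simp_all add: le_iff minus_le_iff flip: linear_neg[OF linear_j])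
    then show "x \<in> {x. \<exists>v. - j v \<le> x \<and> x \<le> j v}" unfolding a by blast
  qed
  then have "riesz_subspace UNIV hull range j \<subseteq> {x. \<exists>v. - j v \<le> x \<and> x \<le> j v}"
    by (rule hull_minimal) (rule riesz_subspace_generated_ideal)
  then show ?thesis using assms that by blast
qed

text \<open>The suprema and infima formed in the hull agree with those of the whole space, hence a Riesz
  subspace of the hull is one of the whole space. Everything else is density together with the
  bounds from the generated ideal.\<close>
theorem riesz_completion_hull: "riesz_completion (riesz_subspace UNIV hull range j) j"
proof -
  let ?S = "riesz_subspace UNIV hull range j"
  have S: "subspace ?S" "\<And>x y. x \<in> ?S \<Longrightarrow> y \<in> ?S \<Longrightarrow> join x y \<in> ?S"
    "\<And>x y. x \<in> ?S \<Longrightarrow> y \<in> ?S \<Longrightarrow> meet x y \<in> ?S"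
    using riesz_subspace_UNIV_hull[of "range j"] unfolding riesz_subspace_iff by blast+
  have range: "range j \<subseteq> ?S" by (rule hull_subset)
  have lub: "isLub ?S {x, y} (join x y)" "isGlb ?S {x, y} (meet x y)" if "x \<in> ?S" "y \<in> ?S" for x y
    using that S by (simp_all add: isLub_restrict isGlb_restrict isLub_join isGlb_meet)
  have riesz: "riesz_space_on ?S" unfolding riesz_space_on_def using S(1) lub by blast
  have dense: "order_dense (range j) ?S"
    unfolding order_dense_def
  proof
    fix x assume x: "x \<in> ?S"
    then obtain v where v: "- j v \<le> x" "x \<le> j v" by (rule hull_majorized)
    have "j (- v) \<le> x" using v(1) by (simp add: linear_neg[OF linear_j])
    then show "isLub ?S {y \<in> range j. y \<le> x} x \<and> isGlb ?S {y \<in> range j. x \<le> y} x"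
      using isLub_below isGlb_above[OF v(2)] x by (blast intro: isLub_restrict isGlb_restrict)
  qed
  have generated: "riesz_subspace ?S hull range j = ?S"
  proof (rule hull_unique[OF range])
    show "riesz_subspace ?S ?S"
      unfolding riesz_subspace_def[of ?S ?S]
    proof (intro conjI ballI)
      fix x y assume xy: "x \<in> ?S" "y \<in> ?S"
      show "\<exists>s\<in>?S. isLub ?S {x, y} s" using lub(1)[OF xy] S(2)[OF xy] by blast
      show "\<exists>t\<in>?S. isGlb ?S {x, y} t" using lub(2)[OF xy] S(3)[OF xy] by blast
    qed (use S(1) in simp_all)
  next
    fix Z assume Z: "range j \<subseteq> Z" "riesz_subspace ?S Z"
    have "riesz_subspace UNIV Z"
      unfolding riesz_subspace_iff
    proof (intro conjI ballI)
      show "subspace Z" using Z(2) by (simp add: riesz_subspace_def)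
      fix x y assume xy: "x \<in> Z" "y \<in> Z"
      then obtain s t where s: "s \<in> Z" "isLub ?S {x, y} s" and t: "t \<in> Z" "isGlb ?S {x, y} t"
        using Z(2) unfolding riesz_subspace_def by blast
      have xy': "x \<in> ?S" "y \<in> ?S" using xy Z(2) by (auto simp: riesz_subspace_def)
      have "s = join x y"
        using s(2) lub(1)[OF xy'] unfolding isLub_def leastP_def setge_def by (auto intro: order.antisym)
      moreover have "t = meet x y"
        using t(2) lub(2)[OF xy'] unfolding isGlb_def greatestP_def setle_def by (auto intro: order.antisym)
      ultimately show "join x y \<in> Z" "meet x y \<in> Z" using s(1) t(1) by simp_all
    qed
    then show "?S \<subseteq> Z" using Z(1) by (intro hull_minimal)
  qed
  show ?thesis
    unfolding riesz_completion_def
    using directed_domain bipositive_archimedean[OF linear_j bipositive_j archimedean]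
      riesz range linear_j bipositive_j dense generated by blast
qed

end

section \<open>Regular operators into an order complete space\<close>

lemma isLub_scaleR:
  fixes A :: "'g::ordered_real_vector set"
  assumes "isLub UNIV A s" "0 < c"
  shows "isLub UNIV ((*\<^sub>R) c ` A) (c *\<^sub>R s)"
  unfolding isLub_UNIV_iff
proof (intro conjI allI impI)
  show "\<forall>a\<in>(*\<^sub>R) c ` A. a \<le> c *\<^sub>R s"
    using assms by (auto simp: isLub_UNIV_iff intro!: scaleR_left_mono)
  fix u assume "\<forall>a\<in>(*\<^sub>R) c ` A. a \<le> u"
  then have "\<forall>a\<in>A. a \<le> inverse c *\<^sub>R u"
    using assms(2) by (auto simp: pos_le_divideR_eq)
  then have "s \<le> inverse c *\<^sub>R u" using assms(1) by (simp add: isLub_UNIV_iff)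
  then show "c *\<^sub>R s \<le> u" using assms(2) by (simp add: pos_le_divideR_eq)
qed

text \<open>Kantorovich's extension: \<open>P x = p (x\<^sup>+) - p (x\<^sup>-)\<close>. Additivity makes \<open>P (a - b) = p a - p b\<close>
  independent of the positive elements \<open>a\<close>, \<open>b\<close> that represent the difference, and linearity follows
  from this freedom.\<close>
lemma additive_extends_to_positive_operator:
  fixes p :: "'e::riesz_space \<Rightarrow> 'g::riesz_space"
  assumes add: "\<And>x y. 0 \<le> x \<Longrightarrow> 0 \<le> y \<Longrightarrow> p (x + y) = p x + p y"
    and scale: "\<And>c x. 0 < c \<Longrightarrow> 0 \<le> x \<Longrightarrow> p (c *\<^sub>R x) = c *\<^sub>R p x"
    and nonneg: "\<And>x. 0 \<le> x \<Longrightarrow> 0 \<le> p x"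
  obtains P where "positive_operator P" "\<And>x. 0 \<le> x \<Longrightarrow> P x = p x"
proof -
  define P where "P x = p (pprt x) - p (- nprt x)" for x
  have nn: "0 \<le> - nprt x" for x :: 'e by simp
  have P_diff: "P (a - b) = p a - p b" if "0 \<le> a" "0 \<le> b" for a b
  proof -
    have "a + (- nprt (a - b)) = b + pprt (a - b)"
      using prts[of "a - b"] by (simp add: algebra_simps)
    then have "p a + p (- nprt (a - b)) = p b + p (pprt (a - b))"
      using add[OF that(1) nn] add[OF that(2) zero_le_pprt] by metis
    then show ?thesis unfolding P_def by (simp add: algebra_simps)
  qed
  have split: "x = pprt x - (- nprt x)" for x :: 'e using prts[of x] by simp
  have p0: "p 0 = 0" using add[of 0 0] by simp
  have P_pos: "P x = p x" if "0 \<le> x" for x using P_diff[OF that order_refl] p0 by simp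
  have "linear P"
  proof (rule linearI)
    fix x y :: 'e and c :: real
    have "x + y = (pprt x + pprt y) - ((- nprt x) + (- nprt y))"
      by (simp only: add_diff_add split[symmetric])
    moreover have "P ((pprt x + pprt y) - ((- nprt x) + (- nprt y))) =
        p (pprt x + pprt y) - p ((- nprt x) + (- nprt y))"
      by (rule P_diff) (simp_all only: add_nonneg_nonneg nn zero_le_pprt)
    ultimately show "P (x + y) = P x + P y"
      by (simp only: add[OF zero_le_pprt zero_le_pprt] add[OF nn nn] P_def add_diff_add)
    consider "c = 0" | "0 < c" | "c < 0" by linarith
    then show "P (c *\<^sub>R x) = c *\<^sub>R P x"
    proof cases
      case 1
      then show ?thesis using P_pos[of 0] p0 by simp
    next
      case 2
      have "c *\<^sub>R x = c *\<^sub>R pprt x - c *\<^sub>R (- nprt x)"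
        by (simp only: scaleR_diff_right[symmetric] split[symmetric])
      moreover have "0 \<le> c *\<^sub>R pprt x" "0 \<le> c *\<^sub>R (- nprt x)"
        using 2 by (simp_all only: scaleR_nonneg_nonneg less_imp_le zero_le_pprt nn)
      ultimately have "P (c *\<^sub>R x) = p (c *\<^sub>R pprt x) - p (c *\<^sub>R (- nprt x))"
        by (simp only: P_diff)
      then show ?thesis
        using scale[OF 2 zero_le_pprt] scale[OF 2 nn] by (simp only: P_def scaleR_diff_right)
    next
      case 3
      then have c: "0 < - c" by simp
      have "- (pprt x - (- nprt x)) = - x" by (simp only: split[symmetric])
      then have "- nprt x - pprt x = - x" by (simp only: minus_diff_eq)
      then have "c *\<^sub>R x = (- c) *\<^sub>R (- nprt x - pprt x)" by simp
      then have "c *\<^sub>R x = (- c) *\<^sub>R (- nprt x) - (- c) *\<^sub>R pprt x"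
        by (simp only: scaleR_diff_right)
      moreover have "0 \<le> (- c) *\<^sub>R pprt x" "0 \<le> (- c) *\<^sub>R (- nprt x)"
        using c by (simp_all only: scaleR_nonneg_nonneg less_imp_le zero_le_pprt nn)
      ultimately have "P (c *\<^sub>R x) = p ((- c) *\<^sub>R (- nprt x)) - p ((- c) *\<^sub>R pprt x)"
        by (simp only: P_diff)
      then have "P (c *\<^sub>R x) = (- c) *\<^sub>R p (- nprt x) - (- c) *\<^sub>R p (pprt x)"
        by (simp only: scale[OF c zero_le_pprt] scale[OF c nn])
      then show ?thesis
        by (simp only: P_def[of x]) (simp add: scaleR_diff_right)
    qed
  qed
  then have "positive_operator P" unfolding positive_operator_def using P_pos nonneg by simp
  then show ?thesis by (rule that) (rule P_pos)
qed

text \<open>A pointwise supremum of candidate values is additive if the candidates at \<open>x + y\<close> and the sums of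
  candidates at \<open>x\<close> and at \<open>y\<close> dominate each other. The two applications are the positive part of
  an operator, where \<open>C x\<close> consists of the values on \<open>[0, x]\<close>, and the supremum of an upward directed
  family of operators, where \<open>C x\<close> consists of the values at \<open>x\<close>.\<close>
lemma positive_operator_of_suprema:
  fixes C :: "'e::riesz_space \<Rightarrow> 'g::riesz_space set"
  assumes oc: "order_complete_on (UNIV :: 'g set)"
    and bounded: "\<And>x. 0 \<le> x \<Longrightarrow> \<exists>u. \<forall>a\<in>C x. a \<le> u"
    and nonneg: "\<And>x. 0 \<le> x \<Longrightarrow> \<exists>a\<in>C x. 0 \<le> a"
    and split: "\<And>x y u. 0 \<le> x \<Longrightarrow> 0 \<le> y \<Longrightarrow> u \<in> C (x + y) \<Longrightarrow> \<exists>a\<in>C x. \<exists>b\<in>C y. u \<le> a + b"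
    and join: "\<And>x y a b. 0 \<le> x \<Longrightarrow> 0 \<le> y \<Longrightarrow> a \<in> C x \<Longrightarrow> b \<in> C y \<Longrightarrow> \<exists>u\<in>C (x + y). a + b \<le> u"
    and scale: "\<And>c x a. 0 < c \<Longrightarrow> 0 \<le> x \<Longrightarrow> a \<in> C x \<Longrightarrow> c *\<^sub>R a \<in> C (c *\<^sub>R x)"
  shows "\<exists>P. positive_operator P \<and> (\<forall>x\<ge>0. isLub UNIV (C x) (P x))"
proof -
  have "\<exists>s. isLub UNIV (C x) s" if "0 \<le> x" for x
  proof -
    have "isUb UNIV (C x) u \<longleftrightarrow> (\<forall>a\<in>C x. a \<le> u)" for u by (simp add: isUb_def setle_def)
    then show ?thesis
      using oc bounded[OF that] nonneg[OF that] unfolding order_complete_on_def by blast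
  qed
  then obtain p where p: "\<And>x. 0 \<le> x \<Longrightarrow> isLub UNIV (C x) (p x)" by metis
  have upper: "a \<le> p x" if "0 \<le> x" "a \<in> C x" for a x
    using p[OF that(1)] that(2) by (simp add: isLub_UNIV_iff)
  have least: "p x \<le> u" if "0 \<le> x" "\<And>a. a \<in> C x \<Longrightarrow> a \<le> u" for u x
    using p[OF that(1)] that(2) by (simp add: isLub_UNIV_iff)
  have p_add: "p (x + y) = p x + p y" if x: "0 \<le> x" and y: "0 \<le> y" for x y
  proof (rule antisym)
    show "p (x + y) \<le> p x + p y"
    proof (rule least)
      fix u assume "u \<in> C (x + y)"
      then obtain a b where "a \<in> C x" "b \<in> C y" "u \<le> a + b" using split[OF x y] by blast
      then show "u \<le> p x + p y" using add_mono[OF upper[OF x] upper[OF y]] by (meson order_trans)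
    qed (use x y in simp)
    have "a + b \<le> p (x + y)" if "a \<in> C x" "b \<in> C y" for a b
      using join[OF x y that] upper[of "x + y"] x y by (meson add_nonneg_nonneg order_trans)
    then have "a \<le> p (x + y) - b" if "a \<in> C x" "b \<in> C y" for a b
      using that by (simp add: le_diff_eq)
    then have "p x \<le> p (x + y) - b" if "b \<in> C y" for b using least[OF x] that by blast
    then have "b \<le> p (x + y) - p x" if "b \<in> C y" for b using that by (simp add: algebra_simps)
    then have "p y \<le> p (x + y) - p x" using least[OF y] by blast
    then show "p x + p y \<le> p (x + y)" by (simp add: algebra_simps)
  qed
  have p_scale_le: "c *\<^sub>R p x \<le> p (c *\<^sub>R x)" if c: "0 < c" and x: "0 \<le> x" for c x
  proof -
    have "a \<le> p (c *\<^sub>R x)" if "a \<in> (*\<^sub>R) c ` C x" for a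
      using that scale[OF c x] upper[of "c *\<^sub>R x"] c x by (auto simp: scaleR_nonneg_nonneg)
    then show ?thesis using isLub_scaleR[OF p[OF x] c] unfolding isLub_UNIV_iff by blast
  qed
  have p_scale: "p (c *\<^sub>R x) = c *\<^sub>R p x" if c: "0 < c" and x: "0 \<le> x" for c x
  proof (rule antisym)
    have "inverse c *\<^sub>R p (c *\<^sub>R x) \<le> p (inverse c *\<^sub>R (c *\<^sub>R x))"
      using c x by (intro p_scale_le) (simp_all add: scaleR_nonneg_nonneg)
    then have "inverse c *\<^sub>R p (c *\<^sub>R x) \<le> p x" using c by simp
    then have "c *\<^sub>R inverse c *\<^sub>R p (c *\<^sub>R x) \<le> c *\<^sub>R p x"
      using c by (intro scaleR_left_mono) simp_all
    then show "p (c *\<^sub>R x) \<le> c *\<^sub>R p x" using c by simp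
  qed (rule p_scale_le[OF that])
  have p_nonneg: "0 \<le> p x" if "0 \<le> x" for x
    using nonneg[OF that] upper[OF that] by (meson order_trans)
  obtain P where "positive_operator P" "\<And>x. 0 \<le> x \<Longrightarrow> P x = p x"
    using additive_extends_to_positive_operator[of p, OF p_add p_scale p_nonneg] by blast
  then show ?thesis using p by (intro exI[of _ P]) simp
qed

lemma app_Regular_operator:
  assumes "positive_operator P"
  shows "app (Regular_operator P) = P"
proof (rule Regular_operator_inverse, rule CollectI, intro exI conjI)
  show "P = (\<lambda>x. P x - 0)" by simp
qed (use assms positive_operator_zero in simp_all)

lemmas app_linear_simps =
  linear_add[OF linear_app] linear_diff[OF linear_app] linear_neg[OF linear_app]
  linear_scale[OF linear_app] linear_0[OF linear_app]

lemma app_minus: "app (S - T) x = app S x - app T x"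
  unfolding minus_regular_operator_def plus_regular_operator.rep_eq uminus_regular_operator.rep_eq
  by simp

lemmas app_pointwise = zero_regular_operator.rep_eq plus_regular_operator.rep_eq app_minus
  uminus_regular_operator.rep_eq scaleR_regular_operator.rep_eq

lemma app_mono: "0 \<le> T \<Longrightarrow> x \<le> y \<Longrightarrow> app T x \<le> app T y"
proof -
  assume "0 \<le> T" "x \<le> y"
  then have "0 \<le> app T (y - x)" by (simp add: less_eq_regular_operator_def app_pointwise)
  then show ?thesis by (simp add: app_linear_simps)
qed

lemma regular_operator_dominated:
  fixes T :: "('e::riesz_space, 'f::riesz_space) regular_operator"
  obtains P where "T \<le> P" "0 \<le> P"
proof -
  obtain P Q where PQ: "positive_operator P" "positive_operator Q" "app T = (\<lambda>x. P x - Q x)"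
    using app[of T] by blast
  have "T \<le> Regular_operator P" "0 \<le> Regular_operator P"
    using PQ by (auto simp: less_eq_regular_operator_def app_Regular_operator app_pointwise positive_operator_def)
  then show ?thesis by (rule that)
qed

lemma directed_regular_operators:
  "directed_on (UNIV :: ('e::riesz_space, 'f::riesz_space) regular_operator set)"
  unfolding directed_on_def
proof (intro ballI)
  fix S T :: "('e, 'f) regular_operator"
  obtain P where P: "S \<le> P" "0 \<le> P" by (rule regular_operator_dominated)
  obtain Q where Q: "T \<le> Q" "0 \<le> Q" by (rule regular_operator_dominated)
  have "S \<le> P + Q" "T \<le> P + Q" using P Q add_mono[OF P(1) Q(2)] add_mono[OF P(2) Q(1)] by simp_all
  then show "\<exists>U\<in>UNIV. S \<le> U \<and> T \<le> U" by blast
qed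

text \<open>The two halves of additivity are the Riesz decomposition of \<open>[0, x + y]\<close>, with
  \<open>z = inf z x + (z - inf z x)\<close>, and \<open>[0, x] + [0, y] \<subseteq> [0, x + y]\<close>.\<close>
theorem riesz_kantorovich:
  fixes T :: "('e::riesz_space, 'g::riesz_space) regular_operator"
  assumes oc: "order_complete_on (UNIV :: 'g set)"
  obtains P where "isLub UNIV {T, 0} P"
    and "\<And>x. 0 \<le> x \<Longrightarrow> isLub UNIV {app T y | y. 0 \<le> y \<and> y \<le> x} (app P x)"
proof -
  obtain U where U: "T \<le> U" "0 \<le> U" by (rule regular_operator_dominated)
  define C where "C x = {app T y | y. 0 \<le> y \<and> y \<le> x}" for x
  have "\<exists>P. positive_operator P \<and> (\<forall>x\<ge>0. isLub UNIV (C x) (P x))"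
  proof (rule positive_operator_of_suprema[OF oc, of C])
    fix x y :: 'e assume x: "0 \<le> x"
    have "app T y \<le> app U x" if "0 \<le> y" "y \<le> x" for y
      using that U app_mono[OF U(2) that(2)] unfolding less_eq_regular_operator_def by (meson order_trans)
    then show "\<exists>u. \<forall>a\<in>C x. a \<le> u" unfolding C_def by blast
    show "\<exists>a\<in>C x. 0 \<le> a"
      using x app_linear_simps(5)[of T] unfolding C_def by (intro bexI[of _ 0]) (auto intro!: exI[of _ 0])
    show "c *\<^sub>R a \<in> C (c *\<^sub>R x)" if "0 < c" "a \<in> C x" for a c
      using that x unfolding C_def
      by (auto simp: scaleR_nonneg_nonneg scaleR_left_mono simp flip: app_linear_simps(4))
    assume y: "0 \<le> y"
    show "\<exists>u\<in>C (x + y). a + b \<le> u" if "a \<in> C x" "b \<in> C y" for a b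
    proof -
      obtain a' b' where "a = app T a'" "0 \<le> a'" "a' \<le> x" "b = app T b'" "0 \<le> b'" "b' \<le> y"
        using \<open>a \<in> C x\<close> \<open>b \<in> C y\<close> unfolding C_def by blast
      then have "a + b = app T (a' + b')" "0 \<le> a' + b'" "a' + b' \<le> x + y"
        by (simp_all add: app_linear_simps add_mono)
      then show ?thesis unfolding C_def by blast
    qed
    show "\<exists>a\<in>C x. \<exists>b\<in>C y. u \<le> a + b" if "u \<in> C (x + y)" for u
    proof -
      obtain z where z: "u = app T z" "0 \<le> z" "z \<le> x + y" using \<open>u \<in> C (x + y)\<close> unfolding C_def by blast
      define a where "a = inf z x"
      have "0 \<le> a" "a \<le> x" "a \<le> z" using x z by (simp_all add: a_def)
      have "z - y \<le> a" using y z unfolding a_def by (simp add: algebra_simps)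
      then have b: "0 \<le> z - a" "z - a \<le> y" using \<open>a \<le> z\<close> by (simp_all add: algebra_simps)
      have "app T a \<in> C x" "app T (z - a) \<in> C y"
        using \<open>0 \<le> a\<close> \<open>a \<le> x\<close> b unfolding C_def by blast+
      moreover have "u \<le> app T a + app T (z - a)" by (simp add: z(1) app_linear_simps)
      ultimately show ?thesis by blast
    qed
  qed
  then obtain P where P: "positive_operator P" "\<And>x. 0 \<le> x \<Longrightarrow> isLub UNIV (C x) (P x)" by blast
  have app_P: "app (Regular_operator P) = P" by (rule app_Regular_operator[OF P(1)])
  have "isLub UNIV {T, 0} (Regular_operator P)"
    unfolding isLub_UNIV_iff
  proof (intro conjI allI impI)
    have "app T x \<le> P x" if "0 \<le> x" for x
      using P(2)[OF that] that unfolding isLub_UNIV_iff C_def by blast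
    then show "\<forall>S\<in>{T, 0}. S \<le> Regular_operator P"
      using P(1) by (simp add: less_eq_regular_operator_def app_P app_pointwise positive_operator_def)
    fix U assume "\<forall>S\<in>{T, 0}. S \<le> U"
    then have U: "T \<le> U" "0 \<le> U" by simp_all
    have "P x \<le> app U x" if "0 \<le> x" for x
    proof -
      have "app T y \<le> app U x" if "0 \<le> y" "y \<le> x" for y
        using that U app_mono[OF U(2) that(2)] unfolding less_eq_regular_operator_def by (meson order_trans)
      then show ?thesis using P(2)[OF that] unfolding isLub_UNIV_iff C_def by blast
    qed
    then show "Regular_operator P \<le> U" by (simp add: less_eq_regular_operator_def app_P)
  qed
  moreover have "isLub UNIV {app T y | y. 0 \<le> y \<and> y \<le> x} (app (Regular_operator P) x)"
    if "0 \<le> x" for x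
    using P(2)[OF that] unfolding C_def app_P .
  ultimately show ?thesis by (rule that)
qed

lemma isLub_add_right:
  fixes x y :: "'a::ordered_ab_group_add"
  assumes "isLub UNIV {x - y, 0} p"
  shows "isLub UNIV {x, y} (p + y)"
proof -
  have "p + y \<le> u" if "x \<le> u" "y \<le> u" for u
  proof -
    have "x - y \<le> u - y" "0 \<le> u - y" using that by (simp_all add: diff_right_mono)
    then have "p \<le> u - y" using assms by (simp add: isLub_UNIV_iff)
    then show ?thesis by (simp add: algebra_simps)
  qed
  then show ?thesis using assms by (auto simp: isLub_UNIV_iff algebra_simps)
qed

text \<open>If \<open>s\<close> is the supremum of the positive multiples of \<open>x\<close>, so that \<open>(n + 1) x \<le> s\<close>, then \<open>s - x\<close> is
  another upper bound.\<close>
lemma order_complete_imp_archimedean: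
  assumes oc: "order_complete_on (UNIV :: 'g::ordered_real_vector set)"
  shows "archimedean_on (UNIV :: 'g set)"
  unfolding archimedean_on_def
proof (intro ballI impI)
  fix x y :: 'g assume le: "\<forall>n::nat. 0 < n \<longrightarrow> real n *\<^sub>R x \<le> y"
  define A where "A = (\<lambda>n. real n *\<^sub>R x) ` {0<..}"
  have "isUb UNIV A y" using le by (auto simp: A_def isUb_def setle_def)
  moreover have "A \<noteq> {}" by (auto simp: A_def)
  ultimately obtain s where s: "isLub UNIV A s" using oc unfolding order_complete_on_def by blast
  have "a \<le> s - x" if a: "a \<in> A" for a
  proof -
    obtain n where n: "a = real n *\<^sub>R x" using a unfolding A_def by blast
    have "real (Suc n) *\<^sub>R x \<le> s" using s unfolding isLub_UNIV_iff A_def by blast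
    then show ?thesis by (simp add: n algebra_simps)
  qed
  then have "s \<le> s - x" using s by (simp add: isLub_UNIV_iff)
  then show "x \<le> 0" by (simp add: algebra_simps)
qed

lemma archimedean_regular_operators:
  assumes "archimedean_on (UNIV :: 'g::riesz_space set)"
  shows "archimedean_on (UNIV :: ('e::riesz_space, 'g) regular_operator set)"
  unfolding archimedean_on_def
proof (intro ballI impI)
  fix S T :: "('e, 'g) regular_operator"
  assume "\<forall>n::nat. 0 < n \<longrightarrow> real n *\<^sub>R S \<le> T"
  then have "\<forall>n::nat. 0 < n \<longrightarrow> real n *\<^sub>R app S x \<le> app T x" if "0 \<le> x" for x
    using that by (simp add: less_eq_regular_operator_def app_pointwise)
  then have "app S x \<le> 0" if "0 \<le> x" for x
    using assms that unfolding archimedean_on_def by blast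
  then show "S \<le> 0" by (simp add: less_eq_regular_operator_def app_pointwise)
qed

locale order_complete_codomain =
  fixes domain_type :: "'e::riesz_space itself" and codomain_type :: "'g::riesz_space itself"
  assumes order_complete: "order_complete_on (UNIV :: 'g set)"
begin

sublocale ops: archimedean_vector_lattice "TYPE(('e, 'g) regular_operator)"
proof
  fix S T :: "('e, 'g) regular_operator"
  obtain P where "isLub UNIV {S - T, 0} P" by (rule riesz_kantorovich[OF order_complete])
  then show "\<exists>P. isLub UNIV {S, T} P" using isLub_add_right by blast
next
  show "archimedean_on (UNIV :: ('e, 'g) regular_operator set)"
    by (intro archimedean_regular_operators order_complete_imp_archimedean order_complete)
qed

lemma riesz_kantorovich_formula:
  fixes T :: "('e, 'g) regular_operator"
  assumes "isLub UNIV {T, 0} P" "0 \<le> x"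
  shows "isLub UNIV {app T y | y. 0 \<le> y \<and> y \<le> x} (app P x)"
proof -
  obtain Q where Q: "isLub UNIV {T, 0} Q"
    "\<And>x. 0 \<le> x \<Longrightarrow> isLub UNIV {app T y | y. 0 \<le> y \<and> y \<le> x} (app Q x)"
    using riesz_kantorovich[OF order_complete, of T] by blast
  show ?thesis using Q(2)[OF assms(2)] isLub_UNIV_unique[OF Q(1) assms(1)] by simp
qed

end

section \<open>Order continuity\<close>

text \<open>The ranges of nets that decrease to \<open>0\<close>. In terms of them order convergence to \<open>0\<close> no longer
  mentions the index set of the dominating net.\<close>
definition null_set :: "'v::ordered_real_vector set \<Rightarrow> bool" where
  "null_set A \<longleftrightarrow> A \<noteq> {} \<and> (\<forall>a\<in>A. \<forall>b\<in>A. \<exists>c\<in>A. c \<le> a \<and> c \<le> b) \<and> isGlb UNIV A 0"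

lemma null_setD:
  assumes "null_set A"
  shows "A \<noteq> {}" "\<And>a. a \<in> A \<Longrightarrow> 0 \<le> a" "\<And>a b. a \<in> A \<Longrightarrow> b \<in> A \<Longrightarrow> \<exists>c\<in>A. c \<le> a \<and> c \<le> b"
    "\<And>l. (\<And>a. a \<in> A \<Longrightarrow> l \<le> a) \<Longrightarrow> l \<le> 0"
  using assms by (simp_all add: null_set_def isGlb_UNIV_iff)

lemma null_setI:
  assumes "A \<noteq> {}" "\<And>a. a \<in> A \<Longrightarrow> 0 \<le> a"
    "\<And>a b. a \<in> A \<Longrightarrow> b \<in> A \<Longrightarrow> \<exists>c\<in>A. c \<le> a \<and> c \<le> b"
    "\<And>l. (\<And>a. a \<in> A \<Longrightarrow> l \<le> a) \<Longrightarrow> l \<le> 0"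
  shows "null_set A"
  using assms by (simp add: null_set_def isGlb_UNIV_iff)

definition downward :: "'v::order set \<Rightarrow> 'v rel" where
  "downward A = {(a, b). a \<in> A \<and> b \<in> A \<and> b \<le> a}"

lemma directed_index_downward:
  assumes A: "null_set A"
  shows "directed_index A (downward A)"
  unfolding directed_index_def
proof (intro conjI ballI)
  show "A \<noteq> {}" by (rule null_setD(1)[OF A])
  show "preorder_on A (downward A)"
    by (auto simp: preorder_on_def refl_on_def downward_def intro: transI)
  show "\<exists>c\<in>A. (a, c) \<in> downward A \<and> (b, c) \<in> downward A" if "a \<in> A" "b \<in> A" for a b
    using null_setD(3)[OF A that] that unfolding downward_def by blast
qed

lemma order_converges_zero_iff:
  "order_converges D r x 0 \<longleftrightarrow>
     (\<exists>A. null_set A \<and> (\<forall>a\<in>A. \<exists>d\<in>D. \<forall>e\<in>D. (d, e) \<in> r \<longrightarrow> \<bar>x e\<bar> \<le> a))"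
  (is "?lhs \<longleftrightarrow> ?rhs")
proof
  assume ?lhs
  then obtain K :: "'b set" and s b where b: "decreases_to_zero K s b" and dom: "dominates D r x 0 K b"
    unfolding order_converges_def by blast
  have s: "directed_index K s" "\<And>c d. (c, d) \<in> s \<Longrightarrow> b d \<le> b c" "isGlb UNIV (b ` K) 0"
    using b unfolding decreases_to_zero_def by blast+
  have "null_set (b ` K)"
    unfolding null_set_def
  proof (intro conjI ballI s(3))
    show "b ` K \<noteq> {}" using s(1) unfolding directed_index_def by blast
    fix u v assume "u \<in> b ` K" "v \<in> b ` K"
    then obtain p q where "p \<in> K" "u = b p" "q \<in> K" "v = b q" by blast
    then show "\<exists>c\<in>b ` K. c \<le> u \<and> c \<le> v"
      using s(1,2) unfolding directed_index_def by (metis imageI)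
  qed
  moreover have "\<forall>a\<in>b ` K. \<exists>d\<in>D. \<forall>e\<in>D. (d, e) \<in> r \<longrightarrow> \<bar>x e\<bar> \<le> a"
    using dom unfolding dominates_def by simp
  ultimately show ?rhs by blast
next
  assume ?rhs
  then obtain A where A: "null_set A" "\<forall>a\<in>A. \<exists>d\<in>D. \<forall>e\<in>D. (d, e) \<in> r \<longrightarrow> \<bar>x e\<bar> \<le> a" by blast
  have "decreases_to_zero A (downward A) (\<lambda>a. a)"
    using directed_index_downward[OF A(1)] A(1) unfolding decreases_to_zero_def null_set_def
    by (simp add: downward_def)
  moreover have "dominates D r x 0 A (\<lambda>a. a)" using A(2) unfolding dominates_def by simp
  ultimately show ?lhs by (rule order_convergesI)
qed

lemma order_continuous_uminus:
  assumes "app T \<in> order_continuous_operators"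
  shows "app (- T) \<in> order_continuous_operators"
proof -
  have "order_converges D r (\<lambda>d. app (- T) (x d)) 0 \<longleftrightarrow> order_converges D r (\<lambda>d. app T (x d)) 0"
    for D :: "('a set \<times> 'a) set" and r x
    unfolding order_converges_zero_iff by (simp add: app_pointwise)
  then show ?thesis
    using assms linear_app[of "- T"] unfolding order_continuous_operators_def by simp
qed

text \<open>A positive operator is normal if it preserves infima of sets that decrease to \<open>0\<close>. For positive
  operators this is order continuity, and it is inherited by smaller operators and by sums without
  any mention of nets.\<close>
definition normal :: "('e::riesz_space, 'f::riesz_space) regular_operator \<Rightarrow> bool" where
  "normal P \<longleftrightarrow> 0 \<le> P \<and> (\<forall>A l. null_set A \<longrightarrow> (\<forall>a\<in>A. l \<le> app P a) \<longrightarrow> l \<le> 0)"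

lemma normal_nonneg: "normal P \<Longrightarrow> 0 \<le> P"
  by (simp add: normal_def)

lemma app_nonneg: "0 \<le> P \<Longrightarrow> 0 \<le> x \<Longrightarrow> 0 \<le> app P x"
  by (simp add: less_eq_regular_operator_def app_pointwise)

lemma app_le: "S \<le> T \<Longrightarrow> 0 \<le> x \<Longrightarrow> app S x \<le> app T x"
  by (simp add: less_eq_regular_operator_def)

lemma normal_le:
  assumes "normal Q" "0 \<le> P" "P \<le> Q"
  shows "normal P"
  unfolding normal_def
proof (intro conjI allI impI)
  fix A l assume A: "null_set A" and l: "\<forall>a\<in>A. l \<le> app P a"
  have "l \<le> app Q a" if "a \<in> A" for a
    using l that app_le[OF assms(3) null_setD(2)[OF A that]] by (meson order_trans)
  then show "l \<le> 0" using assms(1) A unfolding normal_def by blast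
qed (rule assms)

lemma normal_zero: "normal 0"
proof -
  have "l \<le> 0" if "null_set A" "\<forall>a\<in>A. l \<le> app 0 a" for A :: "'a set" and l :: 'b
    using that null_setD(1)[OF that(1)] by (auto simp: app_pointwise)
  then show ?thesis unfolding normal_def by blast
qed

lemma normal_add:
  assumes P: "normal P" and Q: "normal Q"
  shows "normal (P + Q)"
  unfolding normal_def
proof (intro conjI allI impI)
  show "0 \<le> P + Q" using P Q by (simp add: normal_nonneg)
  fix A l assume A: "null_set A" and l: "\<forall>a\<in>A. l \<le> app (P + Q) a"
  have le: "l - app P a \<le> app Q b" if "a \<in> A" "b \<in> A" for a b
  proof -
    obtain c where c: "c \<in> A" "c \<le> a" "c \<le> b" using null_setD(3)[OF A \<open>a \<in> A\<close> \<open>b \<in> A\<close>] by blast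
    have "l \<le> app P c + app Q c" using l c(1) by (simp add: app_pointwise)
    also have "\<dots> \<le> app P a + app Q b"
      using c P Q by (intro add_mono app_mono normal_nonneg)
    finally show ?thesis by (simp add: algebra_simps)
  qed
  have "l - app P a \<le> 0" if "a \<in> A" for a
    using Q A le[OF that] unfolding normal_def by blast
  then have "\<forall>a\<in>A. l \<le> app P a" by simp
  then show "l \<le> 0" using P A unfolding normal_def by blast
qed

lemma normal_scaleR:
  assumes P: "normal P" and c: "0 \<le> c"
  shows "normal (c *\<^sub>R P)"
proof (cases "c = 0")
  case True
  then show ?thesis by (simp add: normal_zero)
next
  case False
  then have c: "0 < c" using c by simp
  show ?thesis
    unfolding normal_def
  proof (intro conjI allI impI)
    show "0 \<le> c *\<^sub>R P" using P c by (simp add: normal_nonneg scaleR_nonneg_nonneg)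
    fix A l assume A: "null_set A" and l: "\<forall>a\<in>A. l \<le> app (c *\<^sub>R P) a"
    have "\<forall>a\<in>A. inverse c *\<^sub>R l \<le> app P a"
    proof
      fix a assume "a \<in> A"
      then have "inverse c *\<^sub>R l \<le> inverse c *\<^sub>R (c *\<^sub>R app P a)"
        using l c by (intro scaleR_left_mono) (simp_all add: app_pointwise)
      then show "inverse c *\<^sub>R l \<le> app P a" using c by simp
    qed
    then have "inverse c *\<^sub>R l \<le> 0" using P A unfolding normal_def by blast
    then have "c *\<^sub>R (inverse c *\<^sub>R l) \<le> c *\<^sub>R 0" using c by (intro scaleR_left_mono) simp_all
    then show "l \<le> 0" using c by simp
  qed
qed

context order_complete_codomain
begin

text \<open>Ogasawara's argument. Let \<open>A\<close> decrease to \<open>0\<close> and let \<open>l\<close> be a lower bound of \<open>P a\<close>, \<open>a \<in> A\<close>. For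
  \<open>0 \<le> y \<le> x\<close> and \<open>c \<le> x\<close> in \<open>A\<close>, the element \<open>y - inf y c\<close> is at most \<open>x - c\<close>, so
  \<open>S y - S (inf y c) \<le> P x - P c \<le> P x - l\<close>. Here \<open>inf y c\<close> tends to \<open>0\<close> along \<open>A\<close>, and order
  continuity of \<open>S\<close> leaves \<open>S y \<le> P x - l\<close>. The supremum over \<open>y\<close> is \<open>P x \<le> P x - l\<close>.\<close>
lemma normal_positive_part:
  fixes S P :: "('e, 'g) regular_operator"
  assumes S: "app S \<in> order_continuous_operators" and lub: "isLub UNIV {S, 0} P"
  shows "normal P"
  unfolding normal_def
proof (intro conjI allI impI)
  show P: "0 \<le> P" using lub by (simp add: isLub_UNIV_iff)
  have SP: "S \<le> P" using lub by (simp add: isLub_UNIV_iff)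
  fix A l assume A: "null_set A" and l: "\<forall>a\<in>A. l \<le> app P a"
  obtain x where x: "x \<in> A" using null_setD(1)[OF A] by blast
  have bound: "app S y \<le> app P x - l" if y: "0 \<le> y" "y \<le> x" for y
  proof -
    have "\<bar>inf y a\<bar> \<le> a" if "a \<in> A" for a
      using y(1) null_setD(2)[OF A that] by simp
    then have "order_converges A (downward A) (\<lambda>a. inf y a) 0"
      unfolding order_converges_zero_iff
    proof (intro exI[of _ A] conjI A ballI)
      fix a assume a: "a \<in> A"
      have "\<bar>inf y e\<bar> \<le> a" if "e \<in> A" "(a, e) \<in> downward A" for e
        using \<open>\<And>a. a \<in> A \<Longrightarrow> \<bar>inf y a\<bar> \<le> a\<close>[OF that(1)] that(2) unfolding downward_def by auto
      then show "\<exists>d\<in>A. \<forall>e\<in>A. (d, e) \<in> downward A \<longrightarrow> \<bar>inf y e\<bar> \<le> a" using a by blast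
    qed
    then have "order_converges A (downward A) (\<lambda>a. app S (inf y a)) 0"
      by (rule order_continuousD[OF S directed_index_downward[OF A]])
    then obtain B where B: "null_set B"
      "\<forall>b\<in>B. \<exists>d\<in>A. \<forall>e\<in>A. (d, e) \<in> downward A \<longrightarrow> \<bar>app S (inf y e)\<bar> \<le> b"
      unfolding order_converges_zero_iff by blast
    have "app S y + l - app P x \<le> b" if "b \<in> B" for b
    proof -
      obtain d where d: "d \<in> A" "\<forall>e\<in>A. (d, e) \<in> downward A \<longrightarrow> \<bar>app S (inf y e)\<bar> \<le> b"
        using B(2) \<open>b \<in> B\<close> by blast
      obtain c where c: "c \<in> A" "c \<le> d" "c \<le> x" using null_setD(3)[OF A d(1) x] by blast
      have "\<bar>app S (inf y c)\<bar> \<le> b" using d c by (simp add: downward_def)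
      then have small: "app S (inf y c) \<le> b" by (rule abs_le_D1)
      have "y - (x - c) \<le> inf y c" using y(2) c(3) by (simp add: algebra_simps add_mono)
      then have "y - inf y c \<le> x - c" by (simp only: diff_le_eq add.commute)
      then have "app P (y - inf y c) \<le> app P (x - c)" by (rule app_mono[OF P])
      moreover have "app S (y - inf y c) \<le> app P (y - inf y c)" 
        by (rule app_le[OF SP]) (simp only: diff_ge_0_iff_ge inf_le1)
      ultimately have "app S (y - inf y c) \<le> app P (x - c)" by (rule order_trans[rotated])
      then have "app S y - app S (inf y c) \<le> app P x - app P c"
        by (simp only: app_linear_simps)
      then have "(app S y - app S (inf y c)) + l \<le> (app P x - app P c) + app P c"
        using l c(1) by (intro add_mono) blast+
      then have "app S y + l - app P x \<le> app S (inf y c)" by (simp add: algebra_simps)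
      then show ?thesis using small by (rule order_trans)
    qed
    then have "app S y + l - app P x \<le> 0" by (rule null_setD(4)[OF B(1)])
    then show ?thesis by (simp add: algebra_simps)
  qed
  have "isLub UNIV {app S y | y. 0 \<le> y \<and> y \<le> x} (app P x)"
    using lub null_setD(2)[OF A x] by (rule riesz_kantorovich_formula)
  then have "app P x \<le> app P x - l" using bound unfolding isLub_UNIV_iff by blast
  then show "l \<le> 0" by (simp add: algebra_simps)
qed

lemma normal_modulus:
  fixes S :: "('e, 'g) regular_operator"
  assumes S: "app S \<in> order_continuous_operators"
  shows "normal (ops.modulus S)"
proof (rule normal_le)
  show "normal (ops.join S 0 + ops.join (- S) 0)"
    using assms by (intro normal_add normal_positive_part[OF _ ops.isLub_join] order_continuous_uminus)
  show "0 \<le> ops.modulus S" by simp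
  show "ops.modulus S \<le> ops.join S 0 + ops.join (- S) 0"
    using add_mono[of S "ops.join S 0" 0 "ops.join (- S) 0"] add_mono[of 0 "ops.join S 0" "- S" "ops.join (- S) 0"]
    by (intro ops.lat.abs_leI) simp_all
qed

lemma app_le_modulus:
  fixes S :: "('e, 'g) regular_operator"
  shows "app S x \<le> app (ops.modulus S) \<bar>x\<bar>"
proof -
  have "app S (pprt x) \<le> app (ops.modulus S) (pprt x)"
    by (intro app_le ops.lat.abs_ge_self) simp
  moreover have "app (- S) (- nprt x) \<le> app (ops.modulus S) (- nprt x)"
    by (intro app_le ops.lat.abs_ge_minus_self) simp
  ultimately have "app S (pprt x) + app S (nprt x) \<le> app (ops.modulus S) (pprt x) + app (ops.modulus S) (- nprt x)"
    by (intro add_mono) (simp_all add: app_pointwise app_linear_simps)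
  then show ?thesis
    using prts[of x] abs_prts[of x] by (metis app_linear_simps(1) diff_conv_add_uminus)
qed

text \<open>The pointwise supremum \<open>R\<close> of the normal operators below \<open>W\<close>. It is linear because the family is
  directed upwards. It is normal because \<open>R (x - c) \<ge> S (x - c)\<close> for every member \<open>S\<close>: a lower bound
  \<open>l\<close> of \<open>R c\<close>, \<open>c \<in> A\<close>, satisfies \<open>l \<le> R x - S x + S c\<close>, hence \<open>S x \<le> R x - l\<close> by normality of
  \<open>S\<close>, and therefore \<open>R x \<le> R x - l\<close>.\<close>
lemma greatest_normal_below:
  fixes W :: "('e, 'g) regular_operator"
  assumes W: "0 \<le> W"
  obtains R where "normal R" "R \<le> W" "\<And>S. normal S \<Longrightarrow> S \<le> W \<Longrightarrow> S \<le> R"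
proof -
  define C where "C x = {app S x | S. normal S \<and> S \<le> W}" for x
  have "\<exists>P. positive_operator P \<and> (\<forall>x\<ge>0. isLub UNIV (C x) (P x))"
  proof (rule positive_operator_of_suprema[OF order_complete, of C])
    fix x y :: 'e assume x: "0 \<le> x"
    show "\<exists>u. \<forall>a\<in>C x. a \<le> u" using app_le[OF _ x] unfolding C_def by blast
    have "app 0 x \<in> C x" using W normal_zero unfolding C_def by blast
    then show "\<exists>a\<in>C x. 0 \<le> a" by (auto simp: app_pointwise)
    show "c *\<^sub>R a \<in> C (c *\<^sub>R x)" if "a \<in> C x" for a c
      using that unfolding C_def by (auto simp flip: app_linear_simps(4))
    assume y: "0 \<le> y"
    show "\<exists>a\<in>C x. \<exists>b\<in>C y. u \<le> a + b" if "u \<in> C (x + y)" for u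
    proof -
      obtain S where S: "normal S" "S \<le> W" "u = app S (x + y)"
        using \<open>u \<in> C (x + y)\<close> unfolding C_def by blast
      then have "app S x \<in> C x" "app S y \<in> C y" "u \<le> app S x + app S y"
        unfolding C_def by (auto simp: app_linear_simps)
      then show ?thesis by blast
    qed
    show "\<exists>u\<in>C (x + y). a + b \<le> u" if "a \<in> C x" "b \<in> C y" for a b
    proof -
      obtain S T where ST: "normal S" "S \<le> W" "a = app S x" "normal T" "T \<le> W" "b = app T y"
        using \<open>a \<in> C x\<close> \<open>b \<in> C y\<close> unfolding C_def by blast
      have nn: "0 \<le> S" "0 \<le> T" using ST by (simp_all add: normal_nonneg)
      have "ops.join S T \<le> S + T" using nn by simp
      moreover have "0 \<le> ops.join S T" using nn(1) by (rule ops.lat.le_supI1)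
      ultimately have "normal (ops.join S T)" using normal_le[OF normal_add[OF ST(1,4)]] by blast
      moreover have "ops.join S T \<le> W" using ST by simp
      ultimately have "app (ops.join S T) (x + y) \<in> C (x + y)" unfolding C_def by blast
      moreover have "a + b \<le> app (ops.join S T) (x + y)"
        unfolding ST app_linear_simps using x y by (intro add_mono app_le) simp_all
      ultimately show ?thesis by blast
    qed
  qed
  then obtain P where P: "positive_operator P" "\<And>x. 0 \<le> x \<Longrightarrow> isLub UNIV (C x) (P x)" by blast
  define R where "R = Regular_operator P"
  have "app R = P" unfolding R_def by (rule app_Regular_operator[OF P(1)])
  then have lub: "isLub UNIV (C x) (app R x)" if "0 \<le> x" for x using P(2)[OF that] by simp
  have R_nonneg: "0 \<le> R"
    using P(1) \<open>app R = P\<close> by (simp add: less_eq_regular_operator_def app_pointwise positive_operator_def)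
  have R_le: "R \<le> W"
    unfolding less_eq_regular_operator_def
  proof (intro allI impI)
    fix x :: 'e assume x: "0 \<le> x"
    have "\<forall>a\<in>C x. a \<le> app W x" using app_le[OF _ x] unfolding C_def by blast
    then show "app R x \<le> app W x" using lub[OF x] unfolding isLub_UNIV_iff by blast
  qed
  have R_ge: "S \<le> R" if "normal S" "S \<le> W" for S
    unfolding less_eq_regular_operator_def using that lub unfolding isLub_UNIV_iff C_def by blast
  have "normal R"
    unfolding normal_def
  proof (intro conjI allI impI R_nonneg)
    fix A l assume A: "null_set A" and l: "\<forall>a\<in>A. l \<le> app R a"
    obtain x where x: "x \<in> A" using null_setD(1)[OF A] by blast
    have "app S x \<le> app R x - l" if S: "normal S" "S \<le> W" for S
    proof -
      have "l - app R x + app S x \<le> app S a" if a: "a \<in> A" for a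
      proof -
        obtain c where c: "c \<in> A" "c \<le> a" "c \<le> x" using null_setD(3)[OF A a x] by blast
        have "app S (x - c) \<le> app R (x - c)" using R_ge[OF S] c(3) by (intro app_le) simp_all
        then have "l + app S (x - c) \<le> app R c + app R (x - c)" using l c(1) by (intro add_mono) blast+
        then have "l - app R x + app S x \<le> app S c" by (simp add: app_linear_simps algebra_simps)
        also have "\<dots> \<le> app S a" using S(1) c(2) by (intro app_mono normal_nonneg)
        finally show ?thesis .
      qed
      then have "l - app R x + app S x \<le> 0" using S(1) A unfolding normal_def by blast
      then show ?thesis by (simp add: algebra_simps)
    qed
    then have "\<forall>a\<in>C x. a \<le> app R x - l" unfolding C_def by blast
    then have "app R x \<le> app R x - l" using lub[OF null_setD(2)[OF A x]] unfolding isLub_UNIV_iff by blast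
    then show "l \<le> 0" by (simp add: algebra_simps)
  qed
  then show ?thesis using R_le R_ge by (rule that)
qed

end

section \<open>Operators with values in a space that has an order completion\<close>

locale completed_codomain = order_complete_codomain domain_type codomain_type
  for domain_type :: "'e::riesz_space itself" and codomain_type :: "'g::riesz_space itself" +
  fixes i :: "'f::riesz_space \<Rightarrow> 'g"
  assumes linear_i: "linear i" and bipositive_i: "bipositive i"
    and majorizing_i: "majorizing (range i) UNIV" and pervasive_i: "pervasive_in (range i) UNIV"
    and pervasive_operators:
      "pervasive_in (regular_operators_into (range i)) (UNIV :: ('e, 'g) regular_operator set)"
begin

abbreviation J :: "('e, 'f) regular_operator \<Rightarrow> ('e, 'g) regular_operator" where
  "J \<equiv> compose_left i"

lemma app_J: "app (J T) x = i (app T x)"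
  by (simp add: app_compose_left[OF linear_i bipositive_i])

sublocale cod: pervasive_embedding codomain_type i
proof (intro pervasive_embedding.intro pervasive_embedding_axioms.intro vector_lattice.intro
    archimedean_vector_lattice.intro archimedean_vector_lattice_axioms.intro)
  show "\<exists>s. isLub UNIV {x, y} s" for x y :: 'g
    by (rule exI[of _ "sup x y"]) (simp add: isLub_UNIV_iff)
  show "directed_on (UNIV :: 'f set)"
    unfolding directed_on_def by (meson UNIV_I sup_ge1 sup_ge2)
qed (rule linear_i bipositive_i pervasive_i order_complete_imp_archimedean[OF order_complete])+

sublocale emb: pervasive_embedding "TYPE(('e, 'g) regular_operator)" J
proof (intro pervasive_embedding.intro pervasive_embedding_axioms.intro)
  have inj: "S = T" if "\<And>x. app S x = app T x" for S T :: "('e, 'g) regular_operator"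
    using that by (simp add: app_inject[symmetric] fun_eq_iff)
  show "linear J"
    by (rule linearI; rule inj)
      (simp_all add: app_J app_pointwise linear_add[OF linear_i] linear_scale[OF linear_i])
  show "bipositive J"
    using bipositive_i unfolding bipositive_def less_eq_regular_operator_def app_J app_pointwise by blast
  show "pervasive_in (range J) UNIV"
    using pervasive_operators unfolding regular_operators_into_range[OF linear_i bipositive_i] .
qed (rule ops.archimedean_vector_lattice_axioms directed_regular_operators)+

lemma i_le_inf: "b \<le> i f1 \<Longrightarrow> b \<le> i f2 \<Longrightarrow> b \<le> i (inf f1 f2)"
proof -
  assume b: "b \<le> i f1" "b \<le> i f2"
  have "isLub UNIV {- f1, - f2} (sup (- f1) (- f2))" by (simp add: isLub_UNIV_iff)
  then have "cod.join (i (- f1)) (i (- f2)) = i (sup (- f1) (- f2))" by (rule cod.join_embedding)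
  moreover have "cod.join (i (- f1)) (i (- f2)) \<le> - b"
    using b by (simp add: linear_neg[OF linear_i])
  ultimately have "i (sup (- f1) (- f2)) \<le> - b" by simp
  then show ?thesis
    by (simp add: neg_inf_eq_sup[symmetric] linear_neg[OF linear_i] del: neg_inf_eq_sup)
qed

lemma null_set_image:
  assumes A: "null_set A"
  shows "null_set (i ` A)"
proof (rule null_setI)
  show "i ` A \<noteq> {}" using null_setD(1)[OF A] by simp
  show "0 \<le> a" if "a \<in> i ` A" for a
    using that null_setD(2)[OF A] bipositive_i unfolding bipositive_def by blast
  show "\<exists>c\<in>i ` A. c \<le> a \<and> c \<le> b" if "a \<in> i ` A" "b \<in> i ` A" for a b
    using that null_setD(3)[OF A] by (fastforce simp: cod.le_iff)
  fix l assume l: "\<And>a. a \<in> i ` A \<Longrightarrow> l \<le> a"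
  obtain w where "- l \<le> i w" using majorizing_i unfolding majorizing_def by blast
  then have "i (- w) \<le> l" by (simp add: linear_neg[OF linear_i] minus_le_iff)
  then have lub: "isLub UNIV {y \<in> range i. y \<le> l} l" by (rule cod.isLub_below)
  have "y \<le> 0" if y: "y \<in> range i" "y \<le> l" for y
  proof -
    obtain v where v: "y = i v" using y(1) by blast
    have "v \<le> a" if "a \<in> A" for a
      using l[of "i a"] \<open>y \<le> l\<close> that unfolding v by (simp add: order_trans flip: cod.le_iff)
    then have "v \<le> 0" by (rule null_setD(4)[OF A])
    then show ?thesis using cod.le_iff[of v 0] by (simp add: v linear_0[OF linear_i])
  qed
  then show "l \<le> 0" using lub unfolding isLub_UNIV_iff by blast
qed

text \<open>Sets that decrease to \<open>0\<close> pass from the completion back to \<open>F\<close> by taking all elements of \<open>F\<close> above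
  some member; density shows that the infimum does not grow. So an operator into \<open>F\<close> is order
  continuous as soon as it is so as an operator into the completion.\<close>
lemma null_set_above:
  assumes B: "null_set B"
  shows "null_set {f. \<exists>b\<in>B. b \<le> i f}"
proof (rule null_setI)
  obtain b where "b \<in> B" using null_setD(1)[OF B] by blast
  then show "{f. \<exists>b\<in>B. b \<le> i f} \<noteq> {}"
    using majorizing_i unfolding majorizing_def by blast
  show "0 \<le> f" if "f \<in> {f. \<exists>b\<in>B. b \<le> i f}" for f
    using that null_setD(2)[OF B] bipositive_i unfolding bipositive_def by (blast intro: order_trans)
  show "\<exists>h\<in>{f. \<exists>b\<in>B. b \<le> i f}. h \<le> f \<and> h \<le> g"
    if f: "f \<in> {f. \<exists>b\<in>B. b \<le> i f}" and g: "g \<in> {f. \<exists>b\<in>B. b \<le> i f}" for f g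
  proof -
    obtain a b where ab: "a \<in> B" "a \<le> i f" "b \<in> B" "b \<le> i g" using f g by blast
    then obtain c where c: "c \<in> B" "c \<le> a" "c \<le> b" using null_setD(3)[OF B] by blast
    have "c \<le> i (inf f g)" using ab c by (intro i_le_inf) (blast intro: order_trans)+
    then show ?thesis using c(1) by (intro bexI[of _ "inf f g"]) auto
  qed
  fix l assume l: "\<And>f. f \<in> {f. \<exists>b\<in>B. b \<le> i f} \<Longrightarrow> l \<le> f"
  have "i l \<le> b" if b: "b \<in> B" for b
  proof -
    obtain w where "b \<le> i w" using majorizing_i unfolding majorizing_def by blast
    then show ?thesis
    proof (rule cod.greatest_below_range)
      fix u assume "b \<le> i u"
      then show "i l \<le> i u" using l b by (auto simp: cod.le_iff)
    qed
  qed
  then have "i l \<le> 0" by (rule null_setD(4)[OF B])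
  then show "l \<le> 0" using cod.le_iff[of l 0] by (simp add: linear_0[OF linear_i])
qed

lemma abs_le_i_iff: "\<bar>i x\<bar> \<le> i y \<longleftrightarrow> \<bar>x\<bar> \<le> y"
  by (simp add: abs_le_iff cod.le_iff flip: linear_neg[OF linear_i])

text \<open>Order continuity of \<open>T\<close> carries over to \<open>J T\<close> and from there to both parts of its modulus.
  Conversely \<open>\<bar>J T x\<bar> \<le> \<bar>J T\<bar> \<bar>x\<bar>\<close>, so the images under \<open>\<bar>J T\<bar>\<close> of the bounds of a null net bound
  the image net.\<close>
lemma order_continuous_iff_normal:
  "app T \<in> order_continuous_operators \<longleftrightarrow> normal (ops.modulus (J T))"
proof
  assume T: "app T \<in> order_continuous_operators"
  have "order_converges D r (\<lambda>d. app (J T) (x d)) 0"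
    if net: "directed_index D r" "order_converges D r x 0" for D :: "('e set \<times> 'e) set" and r x
  proof -
    obtain A where A: "null_set A" "\<forall>a\<in>A. \<exists>d\<in>D. \<forall>e\<in>D. (d, e) \<in> r \<longrightarrow> \<bar>app T (x e)\<bar> \<le> a"
      using order_continuousD[OF T net] unfolding order_converges_zero_iff by blast
    have "\<forall>a\<in>i ` A. \<exists>d\<in>D. \<forall>e\<in>D. (d, e) \<in> r \<longrightarrow> \<bar>app (J T) (x e)\<bar> \<le> a"
      using A(2) by (simp add: app_J abs_le_i_iff)
    then show ?thesis unfolding order_converges_zero_iff using null_set_image[OF A(1)] by blast
  qed
  then have "app (J T) \<in> order_continuous_operators"
    unfolding order_continuous_operators_def using linear_app by blast
  then show "normal (ops.modulus (J T))" by (rule normal_modulus)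
next
  assume M: "normal (ops.modulus (J T))"
  have "order_converges D r (\<lambda>d. app T (x d)) 0"
    if x: "order_converges D r x 0" for D :: "('e set \<times> 'e) set" and r x
  proof -
    obtain A where A: "null_set A" "\<forall>a\<in>A. \<exists>d\<in>D. \<forall>e\<in>D. (d, e) \<in> r \<longrightarrow> \<bar>x e\<bar> \<le> a"
      using x unfolding order_converges_zero_iff by blast
    have M0: "0 \<le> ops.modulus (J T)" by (rule normal_nonneg[OF M])
    define B where "B = app (ops.modulus (J T)) ` A"
    have "null_set B"
    proof (rule null_setI)
      show "B \<noteq> {}" using null_setD(1)[OF A(1)] by (simp add: B_def)
      show "0 \<le> b" if "b \<in> B" for b
        using that app_nonneg[OF M0] null_setD(2)[OF A(1)] unfolding B_def by blast
      show "\<exists>c\<in>B. c \<le> a \<and> c \<le> b" if "a \<in> B" "b \<in> B" for a b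
        using that null_setD(3)[OF A(1)] app_mono[OF M0] unfolding B_def by blast
      show "l \<le> 0" if "\<And>b. b \<in> B \<Longrightarrow> l \<le> b" for l
        using M A(1) that unfolding normal_def B_def by blast
    qed
    moreover have "\<forall>f\<in>{f. \<exists>b\<in>B. b \<le> i f}. \<exists>d\<in>D. \<forall>e\<in>D. (d, e) \<in> r \<longrightarrow> \<bar>app T (x e)\<bar> \<le> f"
    proof
      fix f assume "f \<in> {f. \<exists>b\<in>B. b \<le> i f}"
      then obtain a where a: "a \<in> A" "app (ops.modulus (J T)) a \<le> i f" unfolding B_def by blast
      then obtain d where d: "d \<in> D" "\<forall>e\<in>D. (d, e) \<in> r \<longrightarrow> \<bar>x e\<bar> \<le> a" using A(2) by blast
      have "\<bar>app T (x e)\<bar> \<le> f" if "\<bar>x e\<bar> \<le> a" for e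
      proof -
        have le: "app (ops.modulus (J T)) \<bar>x e\<bar> \<le> i f"
          using app_mono[OF M0 that] a(2) by (rule order_trans)
        have "app (J T) (x e) \<le> i f" "app (J T) (- x e) \<le> i f"
          using order_trans[OF app_le_modulus[of "J T" "x e"] le]
            order_trans[OF app_le_modulus[of "J T" "- x e", unfolded abs_minus_cancel] le] .
        then have "\<bar>i (app T (x e))\<bar> \<le> i f"
          by (simp add: abs_le_iff app_J app_linear_simps linear_neg[OF linear_i])
        then show ?thesis by (simp only: abs_le_i_iff)
      qed
      then show "\<exists>d\<in>D. \<forall>e\<in>D. (d, e) \<in> r \<longrightarrow> \<bar>app T (x e)\<bar> \<le> f" using d by blast
    qed
    ultimately show ?thesis
      unfolding order_converges_zero_iff using null_set_above by blast
  qed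
  then show "app T \<in> order_continuous_operators"
    unfolding order_continuous_operators_def using linear_app by blast
qed

text \<open>By density \<open>J\<close> preserves existing suprema, so \<open>J P\<close> is the positive part of \<open>J T\<close>, for which the
  formula holds in the completion; \<open>i\<close> reflects the resulting supremum.\<close>
lemma riesz_kantorovich_property: "riesz_kantorovich_property TYPE(('e, 'f) regular_operator)"
  unfolding riesz_kantorovich_property_def
proof (intro allI impI)
  fix T P :: "('e, 'f) regular_operator" and x :: 'e
  assume lub: "isLub UNIV {T, 0} P" and x: "0 \<le> x"
  have "ops.join (J T) 0 = J P"
    using emb.join_embedding[OF lub] by (simp add: linear_0[OF emb.linear_j])
  then have "isLub UNIV {J T, 0} (J P)" using ops.isLub_join[of "J T" 0] by simp
  then have "isLub UNIV {app (J T) y | y. 0 \<le> y \<and> y \<le> x} (app (J P) x)"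
    using x by (rule riesz_kantorovich_formula)
  then have sup: "(\<forall>y. 0 \<le> y \<and> y \<le> x \<longrightarrow> i (app T y) \<le> i (app P x)) \<and>
      (\<forall>u. (\<forall>y. 0 \<le> y \<and> y \<le> x \<longrightarrow> i (app T y) \<le> u) \<longrightarrow> i (app P x) \<le> u)"
    unfolding isLub_UNIV_iff app_J by blast
  have "app P x \<le> u" if "\<forall>y. 0 \<le> y \<and> y \<le> x \<longrightarrow> app T y \<le> u" for u
    using sup that by (simp flip: cod.le_iff)
  moreover have "app T y \<le> app P x" if "0 \<le> y \<and> y \<le> x" for y
    using sup that by (simp flip: cod.le_iff)
  ultimately show "isLub UNIV {app T y | y. 0 \<le> y \<and> y \<le> x} (app P x)"
    unfolding isLub_UNIV_iff by blast
qed

text \<open>For \<open>T\<close> in the second disjoint complement let \<open>W = \<bar>J T\<bar>\<close> and let \<open>R\<close> be the greatest normal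
  operator below \<open>W\<close>. If \<open>R < W\<close>, pervasiveness yields \<open>0 < J z \<le> W - R\<close>. Then \<open>z\<close> is disjoint from
  every order continuous \<open>S\<close>, because \<open>c = inf (J z) \<bar>J S\<bar>\<close> is normal and \<open>R + c \<le> W\<close> forces \<open>c = 0\<close>.
  So \<open>T\<close> is disjoint from \<open>z\<close>, which contradicts \<open>0 < J z \<le> \<bar>J T\<bar>\<close>.\<close>
lemma is_band_order_continuous:
  "is_band {T :: ('e, 'f) regular_operator. app T \<in> order_continuous_operators}" (is "is_band ?Y")
proof -
  have Y: "T \<in> ?Y \<longleftrightarrow> normal (ops.modulus (J T))" for T
    by (simp add: order_continuous_iff_normal)
  have "subspace ?Y"
    unfolding subspace_def
  proof (intro conjI ballI allI)
    show "0 \<in> ?Y" unfolding Y by (simp add: linear_0[OF emb.linear_j] normal_zero)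
    fix S assume S: "S \<in> ?Y"
    show "S + T \<in> ?Y" if T: "T \<in> ?Y" for T
      using normal_le[OF normal_add[OF S[unfolded Y] T[unfolded Y]] _ ops.lat.abs_triangle_ineq]
      unfolding Y linear_add[OF emb.linear_j] by simp
    show "c *\<^sub>R S \<in> ?Y" for c
    proof -
      let ?M = "ops.modulus (J S)"
      have "a *\<^sub>R U \<le> \<bar>a\<bar> *\<^sub>R ?M" if "U \<le> ?M" "- U \<le> ?M" for a U
      proof (cases "0 \<le> a")
        case True
        then show ?thesis using scaleR_left_mono[OF that(1)] by simp
      next
        case False
        then show ?thesis using scaleR_left_mono[OF that(2), of "- a"] by simp
      qed
      from this[of "J S" c] this[of "J S" "- c"] have "ops.modulus (c *\<^sub>R J S) \<le> \<bar>c\<bar> *\<^sub>R ?M"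
        by (intro ops.lat.abs_leI) (simp_all add: ops.lat.abs_ge_self ops.lat.abs_ge_minus_self)
      then show ?thesis
        using normal_le[OF normal_scaleR[OF S[unfolded Y], of "\<bar>c\<bar>"], of "ops.modulus (c *\<^sub>R J S)"]
        unfolding Y linear_scale[OF emb.linear_j] by simp
    qed
  qed
  moreover have "?Y \<subseteq> disjoint_complement (disjoint_complement ?Y)"
    unfolding disjoint_complement_def using po_disjoint_commute by blast
  moreover have "T \<in> ?Y" if T: "T \<in> disjoint_complement (disjoint_complement ?Y)" for T
  proof -
    define W where "W = ops.modulus (J T)"
    have "0 \<le> W" by (simp add: W_def)
    then obtain R where R: "normal R" "R \<le> W" "\<And>S. normal S \<Longrightarrow> S \<le> W \<Longrightarrow> S \<le> R"
      using greatest_normal_below by blast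
    have "W = R"
    proof (rule ccontr)
      assume "W \<noteq> R"
      then have "0 < W - R" using R(2) by (simp add: order_less_le)
      then obtain z where z: "0 < J z" "J z \<le> W - R"
        using emb.pervasive_range unfolding pervasive_in_def by blast
      have Jz: "ops.modulus (J z) = J z" using z(1) by simp
      have "po_disjoint z S" if "S \<in> ?Y" for S
      proof -
        let ?c = "ops.meet (J z) (ops.modulus (J S))"
        have "0 \<le> ?c" using z(1) by simp
        then have "normal ?c" using normal_le[OF that[unfolded Y]] by simp
        moreover have "R + ?c \<le> R + (W - R)"
          using z(2) by (intro add_left_mono) (rule ops.lat.le_infI1)
        ultimately have "R + ?c \<le> R" using R(3)[OF normal_add[OF R(1)]] by simp
        then have "?c = 0" using \<open>0 \<le> ?c\<close> by (simp add: order.antisym)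
        then show ?thesis
          unfolding emb.po_disjoint_embedding[symmetric] ops.po_disjoint_iff Jz .
      qed
      then have "z \<in> disjoint_complement ?Y" by (simp add: disjoint_complement_def)
      then have "po_disjoint T z" using T by (simp add: disjoint_complement_def)
      then have "ops.meet W (J z) = 0"
        unfolding emb.po_disjoint_embedding[symmetric] ops.po_disjoint_iff Jz W_def .
      moreover have "J z \<le> W"
        using z(2) add_mono[OF z(2) normal_nonneg[OF R(1)]] by simp
      ultimately show False using z(1) by (simp add: ops.lat.inf_absorb2)
    qed
    then show ?thesis unfolding Y W_def[symmetric] using R(1) by simp
  qed
  ultimately show ?thesis unfolding is_band_def by blast
qed

end

theorem theorem3p2:
  fixes i :: "'f::riesz_space \<Rightarrow> 'g::riesz_space"
  assumes "archimedean_on (UNIV :: 'e::riesz_space set)"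
    and "archimedean_on (UNIV :: 'f set)"
    and "order_completion i"
    and "pervasive_in (regular_operators_into (range i)) (UNIV :: ('e, 'g) regular_operator set)"
  shows "riesz_completion
           (riesz_subspace UNIV hull
              (regular_operators_into (range i) :: ('e, 'g) regular_operator set))
           (compose_left i :: ('e, 'f) regular_operator \<Rightarrow> ('e, 'g) regular_operator) \<and>
         riesz_kantorovich_property TYPE(('e, 'f) regular_operator) \<and>
         is_band {T :: ('e, 'f) regular_operator. app T \<in> order_continuous_operators}"
proof -
  have order_completion: "order_complete_on (UNIV :: 'g set)" "linear i" "bipositive i"
    "majorizing (range i) UNIV" "pervasive_in (range i) UNIV"
    using assms(3) by (simp_all add: order_completion_def)
  interpret completed_codomain "TYPE('e)" "TYPE('g)" i
  proof (intro completed_codomain.intro completed_codomain_axioms.intro order_complete_codomain.intro)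
  qed (rule order_completion assms(4))+
  have "regular_operators_into (range i) = range J"
    by (rule regular_operators_into_range[OF linear_i bipositive_i])
  then show ?thesis
    using emb.riesz_completion_hull riesz_kantorovich_property is_band_order_continuous by simp
qed

end
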